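(* Let condition $\mathbf{L}(V,\varphi,\Psi)$ hold for the process $X$. Consider a set $D\in\mathcal B(\mathcal X)$ with $D\subset\{V\le m\}$ for some $m\in(1,\infty)$, and fix $q\in(0,1)$ and $\varepsilon=(1-q)/2$. For $\delta\in(0,\infty)$ let $\tau_D(\delta)=\inf\{t>\delta:X_t\in D\}$. Then the following statements hold. (a) Let $h:[1,\infty)\to[1,\infty)$ be a non-decreasing continuous function and let $G_h$ be the inverse of the increasing continuous function $v\mapsto\varepsilon h(v)/(v\varphi(1/v))$ on $[1,\infty)$. Then for every $x\in\mathcal X$ there exist constants $C,r_0,\delta\in(0,\infty)$ such that $$\mathbb P_x\left(\int_0^{\tau_D(\delta)}h\circ V(X_s)\,ds\ge r\right)\ge\frac{C}{\Psi(2G_h(r)/(1-q))}\qquad\text{for all }r\in(r_0,\infty).$$ (b) Let $G_1$ be the inverse of the increasing continuous function $v\mapsto\varepsilon/(v\varphi(1/v))$ on $[1,\infty)$. Then for every $x\in\mathcal X$ there exist constants $C,\delta,t_0\in(0,\infty)$ such that $$\mathbb P_x(\tau_D(\delta)\ge t)\ge\frac{C}{\Psi(2G_1(t)/(1-q))}\qquad\text{for all }t\in(t_0,\infty).$$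
   Context: Convention: $\mathbb R_+=[0,\infty)$; $\inf\emptyset=\infty$; "increasing/decreasing" means strictly. Setting: $X=(X_t)_{t\in\mathbb R_+}$ is a strong Markov process with c\`adl\`ag paths on a filtered space $(\Omega,\mathcal F,(\mathcal F_t)_{t\in\mathbb R_+})$, with values in a locally compact separable metric space $\mathcal X$ with Borel $\sigma$-algebra $\mathcal B(\mathcal X)$. $\mathbb P_x,\mathbb E_x$ denote the probability and expectation with $\mathbb P_x(X_0=x)=1$. Standing assumption: $X$ is ergodic and positive Harris recurrent with invariant probability measure $\pi$, i.e. (Harris recurrence) there is a $\sigma$-finite measure $\nu$ on $\mathcal B(\mathcal X)$ such that $\nu(A)>0$ implies $\mathbb P_x(\int_0^\infty \mathbf 1\{X_t\in A\}\,dt=\infty)=1$ for all $x$; (invariance) $\int_{\mathcal X}\mathbb E_x[g(X_t)]\pi(dx)=\int_{\mathcal X} g\,d\pi$ for all bounded measurable $g:\mathcal X\to\mathbb R_+$ and $t\ge0$; (ergodicity) $\lim_{t\to\infty}\|\mathbb P_x(X_t\in\cdot)-\pi(\cdot)\|_{\mathrm{TV}}=0$ for all $x$, where $\|\mu\|_{\mathrm{TV}}=\sup\{|\int g\,d\mu|: g \text{ measurable}, |g|\le1\}$. Condition $\mathbf L(V,\varphi,\Psi)$: $V:\mathcal X\to[1,\infty)$ is continuous with $\limsup_{t\to\infty}V(X_t)=\infty$ $\mathbb P_x$-a.s. for all $x\in\mathcal X$, and there exists $\ell_0\in[1,\infty)$ such that: (i) $\varphi:(0,1]\to\mathbb R_+$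 is non-decreasing and continuous, $r\mapsto r\varphi(1/r)$ is decreasing on $[1,\infty)$, $\lim_{r\to\infty}r\varphi(1/r)=0$, and for some $b\in\mathbb R_+$ and any $x\in\mathcal X$ the process $1/V(X)-\int_0^\cdot\varphi(1/V(X_u))\,du-b\int_0^\cdot\mathbf 1\{V(X_u)\le\ell_0\}\,du$ is an $(\mathcal F_t)$-supermartingale under $\mathbb P_x$; (ii) $\Psi:[1,\infty)\to[1,\infty)$ is differentiable, increasing and submultiplicative (i.e. there is $C\in(0,\infty)$ with $\Psi(r_1+r_2)\le C\Psi(r_1)\Psi(r_2)$ for all $r_1,r_2\in[1,\infty)$), and for any $\ell\in(\ell_0,\infty)$ there is $C_\ell\in(0,\infty)$ with $\mathbb P_x(T^{(r)}<S_{(\ell)})\ge C_\ell/\Psi(r)$ for all $r\in(\ell+1,\infty)$ and $x\in\{\ell+1\le V\}$, where $T^{(r)}=\inf\{t\ge0:V(X_t)>r\}$ and $S_{(\ell)}=\inf\{t\ge0:V(X_t)<\ell\}$. *)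

theory Defs
  imports "HOL-Probability.Probability"
begin

section \<open>Strong Markov processes\<close>

text \<open>
  Time is the half-line \<open>{0..}\<close> of \<^typ>\<open>real\<close>; values of a process or a filtration at
  negative times are never used. Random times take values in \<^typ>\<open>ennreal\<close>. Of the measures
  \<open>M\<close> (the ambient measurable space) and \<open>F t\<close> only the carrier and the sigma-algebra matter.
\<close>

definition extended_filtration :: "'w measure \<Rightarrow> (real \<Rightarrow> 'w measure) \<Rightarrow> ennreal \<Rightarrow> 'w measure"
  where "extended_filtration M F t = (if t = \<infinity> then M else F (enn2real t))"

definition path_space :: "(real \<Rightarrow> 'x::topological_space) measure"
  where "path_space = Pi\<^sub>M {0..} (\<lambda>_. borel)"

definition path_from :: "(real \<Rightarrow> 'w \<Rightarrow> 'x) \<Rightarrow> real \<Rightarrow> 'w \<Rightarrow> real \<Rightarrow> 'x"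
  where "path_from X s \<omega> = (\<lambda>t\<in>{0..}. X (s + t) \<omega>)"

definition cadlag :: "(real \<Rightarrow> 'x::topological_space) \<Rightarrow> bool"
  where "cadlag f \<longleftrightarrow> (\<forall>t\<ge>0. (f \<longlongrightarrow> f t) (at_right t)) \<and> (\<forall>t>0. \<exists>l. (f \<longlongrightarrow> l) (at_left t))"

text \<open>
  The law of the process as a function of the starting point is required to be measurable only on
  events generated by the process, so that \<open>M\<close> and \<open>F\<close> may be enlarged by null sets. In
  \<open>strong_markov\<close>, the conditional law of the process after time \<open>T\<close> given the past up to \<open>T\<close>
  is, on \<open>T < \<infinity>\<close>, the law of the process started at \<open>X T\<close>.
\<close>

locale strong_markov_process =
  fixes M :: "'w measure"
    and F :: "real \<Rightarrow> 'w measure"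
    and P :: "'x::{metric_space, second_countable_topology} \<Rightarrow> 'w measure"
    and X :: "real \<Rightarrow> 'w \<Rightarrow> 'x"
  assumes locally_compact: "locally_compact_space (euclidean :: 'x topology)"
    and subalgebra_F: "\<And>t. 0 \<le> t \<Longrightarrow> subalgebra M (F t)"
    and mono_F: "\<And>s t. 0 \<le> s \<Longrightarrow> s \<le> t \<Longrightarrow> sets (F s) \<subseteq> sets (F t)"
    and prob_space_P: "\<And>x. prob_space (P x)"
    and space_P: "\<And>x. space (P x) = space M"
    and sets_P: "\<And>x. sets (P x) = sets M"
    and adapted: "\<And>t. 0 \<le> t \<Longrightarrow> X t \<in> F t \<rightarrow>\<^sub>M borel"
    and cadlag_paths: "\<And>\<omega>. \<omega> \<in> space M \<Longrightarrow> cadlag (\<lambda>t. X t \<omega>)"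
    and start: "\<And>x. AE \<omega> in P x. X 0 \<omega> = x"
    and measurable_law: "\<And>B. B \<in> sets path_space \<Longrightarrow>
          (\<lambda>x. measure (P x) {\<omega> \<in> space M. path_from X 0 \<omega> \<in> B}) \<in> borel_measurable borel"
    and strong_markov: "\<And>x T B. stopping_time (extended_filtration M F) T \<Longrightarrow>
          B \<in> sets path_space \<Longrightarrow>
          AE \<omega> in P x. T \<omega> < \<infinity> \<longrightarrow>
            real_cond_exp (P x) (filtration.pre_sigma (space M) (extended_filtration M F) T)
              (indicator {\<omega> \<in> space M. T \<omega> < \<infinity> \<and> path_from X (enn2real (T \<omega>)) \<omega> \<in> B}) \<omega>
            = measure (P (X (enn2real (T \<omega>)) \<omega>)) {\<omega>' \<in> space M. path_from X 0 \<omega>' \<in> B}"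
begin

lemma filtration_extended: "filtration (space M) (extended_filtration M F)"
proof
  show "space (extended_filtration M F t) = space M" for t
    using subalgebra_F[of "enn2real t"] by (simp add: extended_filtration_def subalgebra_def)
  show "sets (extended_filtration M F s) \<subseteq> sets (extended_filtration M F t)" if "s \<le> t" for s t
  proof (cases "t = \<infinity>")
    case True
    then show ?thesis
      using subalgebra_F[of "enn2real s"] by (auto simp: extended_filtration_def subalgebra_def)
  next
    case False
    then have "s \<noteq> \<infinity>" "enn2real s \<le> enn2real t"
      using that by (auto simp: top.not_eq_extremum intro: enn2real_mono)
    then show ?thesis
      using False mono_F[of "enn2real s" "enn2real t"] by (simp add: extended_filtration_def)
  qed
qed

end

text \<open>The total variation norm of the difference of two finite Borel measures.\<close>

definition tv_dist :: "'x::topological_space measure \<Rightarrow> 'x measure \<Rightarrow> real"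
  where "tv_dist \<mu> \<nu> =
    (SUP g\<in>{g \<in> borel_measurable borel. \<forall>x. \<bar>g x\<bar> \<le> 1}. \<bar>(\<integral>x. g x \<partial>\<mu>) - (\<integral>x. g x \<partial>\<nu>)\<bar>)"

text \<open>
  As usual, the measure \<open>\<nu>\<close> in the definition of Harris recurrence is non-trivial; the condition
  would be void for \<open>\<nu> = 0\<close>.
\<close>

locale ergodic_harris_process = strong_markov_process M F P X
  for M :: "'w measure"
    and F :: "real \<Rightarrow> 'w measure"
    and P :: "'x::{metric_space, second_countable_topology} \<Rightarrow> 'w measure"
    and X :: "real \<Rightarrow> 'w \<Rightarrow> 'x" +
  fixes \<pi> :: "'x measure"
  assumes harris_recurrent: "\<exists>\<nu>. sigma_finite_measure \<nu> \<and> sets \<nu> = sets borel \<and> emeasure \<nu> UNIV > 0 \<and>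
          (\<forall>A\<in>sets borel. emeasure \<nu> A > 0 \<longrightarrow>
            (\<forall>x. AE \<omega> in P x. (\<integral>\<^sup>+t\<in>{0..}. indicator A (X t \<omega>) \<partial>lborel) = \<infinity>))"
    and prob_space_pi: "prob_space \<pi>"
    and sets_pi: "sets \<pi> = sets borel"
    and invariant: "\<And>g t. g \<in> borel_measurable borel \<Longrightarrow> (\<And>x. 0 \<le> g x) \<Longrightarrow> bounded (range g) \<Longrightarrow>
          0 \<le> t \<Longrightarrow> (\<integral>x. (\<integral>\<omega>. g (X t \<omega>) \<partial>P x) \<partial>\<pi>) = (\<integral>x. (g x :: real) \<partial>\<pi>)"
    and ergodic: "\<And>x. ((\<lambda>t. tv_dist (distr (P x) borel (X t)) \<pi>) \<longlongrightarrow> 0) at_top"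


section \<open>The condition L\<close>

definition supermartingale :: "'w measure \<Rightarrow> (real \<Rightarrow> 'w measure) \<Rightarrow> (real \<Rightarrow> 'w \<Rightarrow> real) \<Rightarrow> bool"
  where "supermartingale M F Y \<longleftrightarrow>
    (\<forall>t\<ge>0. Y t \<in> borel_measurable (F t) \<and> integrable M (Y t)) \<and>
    (\<forall>s t. 0 \<le> s \<longrightarrow> s \<le> t \<longrightarrow> (AE \<omega> in M. real_cond_exp M (F s) (Y t) \<omega> \<le> Y s \<omega>))"

definition time_above :: "('x \<Rightarrow> real) \<Rightarrow> (real \<Rightarrow> 'w \<Rightarrow> 'x) \<Rightarrow> real \<Rightarrow> 'w \<Rightarrow> ennreal"
  where "time_above V X r \<omega> = (INF t\<in>{t. 0 \<le> t \<and> V (X t \<omega>) > r}. ennreal t)"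

definition time_below :: "('x \<Rightarrow> real) \<Rightarrow> (real \<Rightarrow> 'w \<Rightarrow> 'x) \<Rightarrow> real \<Rightarrow> 'w \<Rightarrow> ennreal"
  where "time_below V X l \<omega> = (INF t\<in>{t. 0 \<le> t \<and> V (X t \<omega>) < l}. ennreal t)"

definition condition_L ::
  "(real \<Rightarrow> 'w measure) \<Rightarrow> ('x::topological_space \<Rightarrow> 'w measure) \<Rightarrow> (real \<Rightarrow> 'w \<Rightarrow> 'x) \<Rightarrow>
   ('x \<Rightarrow> real) \<Rightarrow> (real \<Rightarrow> real) \<Rightarrow> (real \<Rightarrow> real) \<Rightarrow> bool"
  where "condition_L F P X V \<phi> \<Psi> \<longleftrightarrow>
    (\<forall>x. 1 \<le> V x) \<and> continuous_on UNIV V \<and>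
    (\<forall>x. AE \<omega> in P x. Limsup at_top (\<lambda>t. ereal (V (X t \<omega>))) = \<infinity>) \<and>
    (\<exists>l0\<ge>1.
      (\<forall>s\<in>{0<..1}. 0 \<le> \<phi> s) \<and> mono_on {0<..1} \<phi> \<and> continuous_on {0<..1} \<phi> \<and>
      strict_antimono_on {1..} (\<lambda>r. r * \<phi> (1 / r)) \<and>
      ((\<lambda>r. r * \<phi> (1 / r)) \<longlongrightarrow> 0) at_top \<and>
      (\<exists>b\<ge>0. \<forall>x. supermartingale (P x) F
        (\<lambda>t \<omega>. 1 / V (X t \<omega>)
           - (LBINT u:{0..t}. \<phi> (1 / V (X u \<omega>)))
           - b * (LBINT u:{0..t}. indicator {u. V (X u \<omega>) \<le> l0} u))) \<and>
      (\<forall>r\<ge>1. 1 \<le> \<Psi> r) \<and> \<Psi> differentiable_on {1..} \<and> strict_mono_on {1..} \<Psi> \<and>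
      (\<exists>C>0. \<forall>r1\<ge>1. \<forall>r2\<ge>1. \<Psi> (r1 + r2) \<le> C * \<Psi> r1 * \<Psi> r2) \<and>
      (\<forall>l>l0. \<exists>C>0. \<forall>r>l + 1. \<forall>x. l + 1 \<le> V x \<longrightarrow>
        measure (P x) {\<omega> \<in> space (P x). time_above V X r \<omega> < time_below V X l \<omega>} \<ge> C / \<Psi> r))"


section \<open>Return times\<close>

definition return_time :: "(real \<Rightarrow> 'w \<Rightarrow> 'x) \<Rightarrow> 'x set \<Rightarrow> real \<Rightarrow> 'w \<Rightarrow> ennreal"
  where "return_time X D \<delta> \<omega> = (INF t\<in>{t. t > \<delta> \<and> X t \<omega> \<in> D}. ennreal t)"

text \<open>The inverse of the increasing function
  \<open>v \<mapsto> \<epsilon> h(v) / (v \<phi>(1/v))\<close> on \<open>{1..}\<close>; it is only meaningful on the image of \<open>{1..}\<close>.\<close>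

definition G_inv :: "real \<Rightarrow> (real \<Rightarrow> real) \<Rightarrow> (real \<Rightarrow> real) \<Rightarrow> real \<Rightarrow> real"
  where "G_inv \<epsilon> \<phi> h = inv_into {1..} (\<lambda>v. \<epsilon> * h v / (v * \<phi> (1 / v)))"

text \<open>
  The return time to a Borel set is in general not measurable with respect to the given
  sigma-algebra, only with respect to its completion (debut theorem). Since \<^const>\<open>measure\<close> is
  zero on non-measurable sets, the probability of events given by return times is written as
  \<open>event_prob\<close>, the inner probability; by the two lemmas below it is the usual probability of
  every event that is measurable, or measurable with respect to the completion.
\<close>

definition event_prob :: "'w measure \<Rightarrow> 'w set \<Rightarrow> real"
  where "event_prob M E = (SUP A\<in>{A \<in> sets M. A \<subseteq> E}. measure M A)"

lemma event_prob_measurable: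
  assumes "finite_measure M" and "E \<in> sets M"
  shows "event_prob M E = measure M E"
  unfolding event_prob_def
proof (rule cSup_eq_maximum)
  show "measure M E \<in> measure M ` {A \<in> sets M. A \<subseteq> E}"
    using assms(2) by auto
  show "p \<le> measure M E" if "p \<in> measure M ` {A \<in> sets M. A \<subseteq> E}" for p
    using that finite_measure.finite_measure_mono[OF assms(1) _ assms(2)] by auto
qed

lemma event_prob_completion:
  assumes "finite_measure M" and "E \<in> sets (completion M)"
  shows "event_prob M E = measure (completion M) E"
  unfolding event_prob_def
proof (rule cSup_eq_maximum)
  have "main_part M E \<in> sets M" "main_part M E \<subseteq> E"
    using main_part_sets[OF assms(2)] main_part_null_part_Un[OF assms(2)] by blast+
  moreover have "measure M (main_part M E) = measure (completion M) E"
    using emeasure_completion[OF assms(2)] by (simp add: measure_def)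
  ultimately show "measure (completion M) E \<in> measure M ` {A \<in> sets M. A \<subseteq> E}"
    by (metis (mono_tags, lifting) image_eqI mem_Collect_eq)
  show "p \<le> measure (completion M) E" if p: "p \<in> measure M ` {A \<in> sets M. A \<subseteq> E}" for p
  proof -
    obtain A where A: "A \<in> sets M" "A \<subseteq> E" "p = measure M A"
      using p by auto
    have "emeasure M A \<le> emeasure (completion M) E"
      using A emeasure_mono[OF A(2) assms(2)] by simp
    moreover have "emeasure (completion M) E < \<infinity>"
      using emeasure_completion[OF assms(2)] finite_measure.emeasure_finite[OF assms(1)]
      by (simp add: top.not_eq_extremum)
    ultimately show ?thesis
      unfolding A(3) measure_def by (intro enn2real_mono) auto
  qed
qed

end

theory Submission
  imports Defs
begin

text \<open>
  If \<open>V\<close> exceeds \<open>r = 2 v / (1 - q)\<close> at some moment, then with probability at least \<open>q\<close> it stays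
  above \<open>v\<close> for a further time \<open>t = \<epsilon> / (v \<phi> (1 / v))\<close>. Indeed, let \<open>S\<close> be the first time below \<open>v\<close>.
  Above \<open>v > l0\<close> the drift of the supermartingale \<open>1 / V(X) - drift\<close> accumulates at rate at most
  \<open>\<phi> (1 / v)\<close>, so the mean of \<open>1 / V(X)\<close> at time \<open>min S t\<close> is at most \<open>1 / r + t \<phi> (1 / v)\<close>; by
  Markov's inequality, \<open>S < t\<close> has probability at most
  \<open>v / r + v t \<phi> (1 / v) = \<epsilon> + \<epsilon> = 1 - q\<close> (lemma \<open>stay_probability\<close>).
  On such an excursion the additive functional gains \<open>h v * t = \<epsilon> h v / (v \<phi> (1 / v))\<close>, which is the
  prescribed gain exactly when \<open>v\<close> is the value of \<open>G_inv\<close> at it.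

  It remains to reach \<open>r\<close> without visiting \<open>D\<close>. Since \<open>V(X)\<close> is unbounded, at some fixed time \<open>\<delta> > 0\<close>
  the process is above \<open>l + 1\<close> with positive probability, where \<open>l > max l0 m\<close>. From there condition
  L bounds the probability of exceeding \<open>r\<close> before falling below \<open>l\<close>, and hence before meeting \<open>D\<close>,
  by \<open>C / \<Psi> r\<close> from below. The Markov property at the passage above \<open>r\<close> multiplies the three
  probabilities (lemmas \<open>excursion_probability\<close> and \<open>long_excursion_lower_bound\<close>).

  The filtration need not be right-continuous, so neither \<open>S\<close> nor the passage time above \<open>r\<close> has to be
  a stopping time. The optional stopping argument is therefore carried out on finite grids of
  times, whose mesh then tends to zero, and the passage above \<open>r\<close> is replaced by the countably many
  rational times at which \<open>V\<close> exceeds \<open>r\<close>; this way only the Markov property at deterministic times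
  enters.
\<close>

section \<open>Right-continuous functions\<close>

lemma rational_right_of:
  fixes s e :: real
  assumes "eventually Q (at_right s)" and "s < e"
  obtains u where "u \<in> \<rat>" "s < u" "u < e" "Q u"
proof -
  obtain b where b: "b > s" "\<And>y. s < y \<Longrightarrow> y < b \<Longrightarrow> Q y"
    using assms(1) unfolding eventually_at_right_field by blast
  obtain u where "u \<in> \<rat>" "s < u" "u < min b e"
    using Rats_dense_in_real[of s "min b e"] b(1) assms(2) by auto
  then show thesis
    using that b(2) by auto
qed

lemma right_continuous_le:
  fixes f :: "real \<Rightarrow> real"
  assumes "(f \<longlongrightarrow> f s) (at_right s)" and "s < e"
    and "\<And>u. u \<in> \<rat> \<Longrightarrow> s < u \<Longrightarrow> u < e \<Longrightarrow> f u \<le> c"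
  shows "f s \<le> c"
proof (rule ccontr)
  assume "\<not> f s \<le> c"
  then have "eventually (\<lambda>u. c < f u) (at_right s)"
    using assms(1) by (intro order_tendstoD(1)) auto
  then show False
    using rational_right_of[OF _ assms(2)] assms(3) by (metis not_le)
qed

lemma right_continuous_ge:
  fixes f :: "real \<Rightarrow> real"
  assumes "(f \<longlongrightarrow> f s) (at_right s)" and "s < e"
    and "\<And>u. u \<in> \<rat> \<Longrightarrow> s < u \<Longrightarrow> u < e \<Longrightarrow> c \<le> f u"
  shows "c \<le> f s"
  using right_continuous_le[of "\<lambda>u. - f u" s e "- c"] assms tendsto_minus[OF assms(1)] by auto

text \<open>A right-continuous function is the limit of the step functions that evaluate it at the next
  point strictly to the right in the lattice of mesh \<open>1 / (n + 1)\<close>.\<close>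

lemma borel_measurable_right_continuous:
  fixes f :: "real \<Rightarrow> real"
  assumes "\<And>s. (f \<longlongrightarrow> f s) (at_right s)"
  shows "f \<in> borel_measurable borel"
proof (rule borel_measurable_LIMSEQ_real)
  define g :: "nat \<Rightarrow> real \<Rightarrow> real"
    where "g n u = (of_int \<lfloor>real (Suc n) * u\<rfloor> + 1) / real (Suc n)" for n u
  have lower: "u < g n u" for n u
    using floor_correct[of "real (Suc n) * u"]
    by (simp add: g_def pos_less_divide_eq mult.commute[of u] del: of_nat_Suc)
  have upper: "g n u \<le> u + 1 / real (Suc n)" for n u
  proof -
    have "g n u \<le> (real (Suc n) * u + 1) / real (Suc n)"
      unfolding g_def by (rule divide_right_mono) auto
    then show ?thesis
      by (simp add: add_divide_distrib del: of_nat_Suc)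
  qed
  show "(\<lambda>n. f (g n u)) \<longlonglongrightarrow> f u" for u
  proof (rule filterlim_compose[OF assms])
    have "(\<lambda>n. u + 1 / real (Suc n)) \<longlonglongrightarrow> u + 0"
      by (intro tendsto_intros LIMSEQ_Suc[OF lim_1_over_n])
    then have "(\<lambda>n. u + 1 / real (Suc n)) \<longlonglongrightarrow> u"
      by (simp del: of_nat_Suc)
    from tendsto_sandwich[OF _ _ tendsto_const this, of "\<lambda>n. g n u"]
    have "(\<lambda>n. g n u) \<longlonglongrightarrow> u"
      using lower upper by (simp add: less_imp_le del: of_nat_Suc)
    then show "filterlim (\<lambda>n. g n u) (at_right u) sequentially"
      using lower by (simp add: filterlim_at less_imp_neq[THEN not_sym])
  qed
  show "(\<lambda>u. f (g n u)) \<in> borel_measurable borel" for n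
    unfolding g_def
    by (rule measurable_compose_countable[where g="\<lambda>u. \<lfloor>real (Suc n) * u\<rfloor>"
          and f="\<lambda>i _. f ((of_int i + 1) / real (Suc n))"]) measurable
qed

section \<open>Discrete optional stopping\<close>

lemma supermartingale_set_integral_le:
  assumes "finite_measure Q" and "subalgebra Q (F s)" and "supermartingale Q F Z"
    and "0 \<le> s" and "s \<le> t" and "A \<in> sets (F s)"
  shows "(\<integral>\<omega>. indicator A \<omega> * (Z t \<omega> - Z s \<omega>) \<partial>Q) \<le> (0 :: real)"
proof -
  interpret Q: finite_measure Q by fact
  interpret finite_measure_subalgebra Q "F s"
    by unfold_locales fact
  have A: "A \<in> sets Q"
    using assms(2,6) by (auto simp: subalgebra_def)
  have Z: "integrable Q (Z s)" "integrable Q (Z t)"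
    and le: "AE \<omega> in Q. real_cond_exp Q (F s) (Z t) \<omega> \<le> Z s \<omega>"
    using assms unfolding supermartingale_def by auto
  have I: "integrable Q (\<lambda>\<omega>. indicator A \<omega> * f \<omega>)" if "integrable Q f" for f :: "_ \<Rightarrow> real"
    using A that by (subst mult.commute) (rule integrable_real_mult_indicator)
  have "(\<integral>\<omega>. indicator A \<omega> * Z t \<omega> \<partial>Q) = (\<integral>\<omega>. indicator A \<omega> * real_cond_exp Q (F s) (Z t) \<omega> \<partial>Q)"
    using real_cond_exp_intA[OF Z(2) assms(6)] by (simp add: set_lebesgue_integral_def)
  also have "\<dots> \<le> (\<integral>\<omega>. indicator A \<omega> * Z s \<omega> \<partial>Q)"
  proof (rule integral_mono_AE[OF I[OF real_cond_exp_int(1)[OF Z(2)]] I[OF Z(1)]])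
    show "AE \<omega> in Q. indicator A \<omega> * real_cond_exp Q (F s) (Z t) \<omega> \<le> indicator A \<omega> * Z s \<omega>"
      using le by eventually_elim (simp add: indicator_def)
  qed
  finally show ?thesis
    unfolding right_diff_distrib Bochner_Integration.integral_diff[OF I[OF Z(2)] I[OF Z(1)]]
    by linarith
qed

text \<open>When the events \<open>A i\<close> decrease, the process below is \<open>Z\<close> stopped at the first \<open>\<tau> i\<close> at which
  \<open>A i\<close> fails, so this is optional stopping for finitely many times. It is the martingale transform
  by \<open>indicator (A i)\<close>, and each summand has nonpositive mean because \<open>A i\<close> is known at time \<open>\<tau> i\<close>.\<close>

lemma supermartingale_discrete_stopping:
  assumes "finite_measure Q" and "\<And>i. subalgebra Q (F (\<tau> i))" and "supermartingale Q F Z"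
    and "0 \<le> \<tau> 0" and "mono \<tau>" and "\<And>i. A i \<in> sets (F (\<tau> i))"
  shows "integrable Q (\<lambda>\<omega>. Z (\<tau> 0) \<omega> + (\<Sum>i<N. indicator (A i) \<omega> * (Z (\<tau> (Suc i)) \<omega> - Z (\<tau> i) \<omega>)))"
    and "(\<integral>\<omega>. Z (\<tau> 0) \<omega> + (\<Sum>i<N. indicator (A i) \<omega> * (Z (\<tau> (Suc i)) \<omega> - Z (\<tau> i) \<omega>)) \<partial>Q)
      \<le> (\<integral>\<omega>. Z (\<tau> 0) \<omega> \<partial>Q)"
proof -
  have \<tau>: "0 \<le> \<tau> i" "\<tau> i \<le> \<tau> (Suc i)" for i
    using assms(4,5) monoD[OF assms(5), of 0 i] monoD[OF assms(5), of i "Suc i"] by auto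
  have A: "A i \<in> sets Q" for i
    using assms(2)[of i] assms(6)[of i] by (auto simp: subalgebra_def)
  have Z: "integrable Q (Z (\<tau> i))" for i
    using assms(3) \<tau> by (auto simp: supermartingale_def)
  have I: "integrable Q (\<lambda>\<omega>. indicator (A i) \<omega> * (Z (\<tau> (Suc i)) \<omega> - Z (\<tau> i) \<omega>))" for i
    using A Z by (subst mult.commute) (intro integrable_real_mult_indicator Bochner_Integration.integrable_diff)
  show "integrable Q (\<lambda>\<omega>. Z (\<tau> 0) \<omega> + (\<Sum>i<N. indicator (A i) \<omega> * (Z (\<tau> (Suc i)) \<omega> - Z (\<tau> i) \<omega>)))"
    using I Z by (intro Bochner_Integration.integrable_add Bochner_Integration.integrable_sum)
  have "(\<Sum>i<N. \<integral>\<omega>. indicator (A i) \<omega> * (Z (\<tau> (Suc i)) \<omega> - Z (\<tau> i) \<omega>) \<partial>Q) \<le> 0"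
    using assms \<tau> by (intro sum_nonpos supermartingale_set_integral_le[where F=F]) auto
  then show "(\<integral>\<omega>. Z (\<tau> 0) \<omega> + (\<Sum>i<N. indicator (A i) \<omega> * (Z (\<tau> (Suc i)) \<omega> - Z (\<tau> i) \<omega>)) \<partial>Q)
      \<le> (\<integral>\<omega>. Z (\<tau> 0) \<omega> \<partial>Q)"
    unfolding Bochner_Integration.integral_add[OF Z Bochner_Integration.integrable_sum[OF I]]
      Bochner_Integration.integral_sum[OF I]
    by linarith
qed


section \<open>The Markov property at deterministic times\<close>

context strong_markov_process
begin

lemma subalgebra_P: "0 \<le> s \<Longrightarrow> subalgebra (P x) (F s)"
  using subalgebra_F[of s] by (simp add: subalgebra_def space_P sets_P)

lemma measurable_X: "0 \<le> s \<Longrightarrow> X s \<in> M \<rightarrow>\<^sub>M borel"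
  using measurable_from_subalg[OF subalgebra_F adapted] .

lemma measurable_X_later:
  assumes "0 \<le> u" and "u \<le> s"
  shows "X u \<in> F s \<rightarrow>\<^sub>M borel"
proof (rule measurable_from_subalg[OF _ adapted[OF assms(1)]])
  have "space (F u) = space M" "space (F s) = space M"
    using subalgebra_F[of u] subalgebra_F[of s] assms by (simp_all add: subalgebra_def)
  then show "subalgebra (F s) (F u)"
    using mono_F[OF assms] by (simp add: subalgebra_def)
qed

lemma measurable_path_from: "0 \<le> s \<Longrightarrow> path_from X s \<in> M \<rightarrow>\<^sub>M path_space"
  unfolding path_from_def path_space_def
  by (intro measurable_restrict measurable_X) auto

text \<open>The strong Markov property at the constant time \<open>s\<close>, integrated over \<open>A\<close>. A pointwise lower
  bound on the laws of the restarted process suffices here, so that no integral of such laws has to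
  be formed.\<close>

lemma markov_ge:
  assumes s: "0 \<le> s" and A: "A \<in> sets (F s)" and B: "B \<in> sets path_space"
    and ge: "\<And>\<omega>. \<omega> \<in> A \<Longrightarrow> c \<le> measure (P (X s \<omega>)) {\<omega>' \<in> space M. path_from X 0 \<omega>' \<in> B}"
  shows "c * measure (P x) A \<le> measure (P x) {\<omega> \<in> A. path_from X s \<omega> \<in> B}"
proof -
  interpret Px: prob_space "P x" by (rule prob_space_P)
  interpret E: filtration "space M" "extended_filtration M F" by (rule filtration_extended)
  define T :: "'w \<Rightarrow> ennreal" where "T = (\<lambda>_. ennreal s)"
  define G where "G = filtration.pre_sigma (space M) (extended_filtration M F) T"
  have st: "stopping_time (extended_filtration M F) T"
    unfolding T_def stopping_time_def by simp
  have F_s: "extended_filtration M F (ennreal s) = F s"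
    using s by (simp add: extended_filtration_def)
  have AM: "A \<in> sets M" "A \<subseteq> space M"
    using subalgebra_F[OF s] A sets.sets_into_space[OF A] by (auto simp: subalgebra_def)
  have sets_G: "sets G = {A. \<forall>t. {\<omega> \<in> A. T \<omega> \<le> t} \<in> sets (extended_filtration M F t)}"
    unfolding G_def by (rule E.sets_pre_sigma[OF st])
  have AG: "A \<in> sets G"
    unfolding sets_G
  proof (intro CollectI allI)
    show "{\<omega> \<in> A. T \<omega> \<le> t} \<in> sets (extended_filtration M F t)" for t
    proof (cases "ennreal s \<le> t")
      case True
      then show ?thesis
        using A E.sets_F_mono[OF True] F_s by (simp add: T_def subset_iff)
    qed (simp add: T_def)
  qed
  have "subalgebra (P x) G"
    unfolding subalgebra_def
  proof
    show "space G = space (P x)"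
      by (simp add: G_def E.space_pre_sigma space_P)
    show "sets G \<subseteq> sets (P x)"
    proof
      fix A' assume "A' \<in> sets G"
      then have "{\<omega> \<in> A'. T \<omega> \<le> \<infinity>} \<in> sets (extended_filtration M F \<infinity>)"
        unfolding sets_G by blast
      then show "A' \<in> sets (P x)"
        by (simp add: extended_filtration_def sets_P)
    qed
  qed
  then interpret finite_measure_subalgebra "P x" G
    by unfold_locales
  define H where "H = {\<omega> \<in> space M. T \<omega> < \<infinity> \<and> path_from X (enn2real (T \<omega>)) \<omega> \<in> B}"
  have H_eq: "H = {\<omega> \<in> space M. path_from X s \<omega> \<in> B}"
    unfolding H_def T_def using s by simp
  have HM: "H \<in> sets (P x)"
    using measurable_sets[OF measurable_path_from[OF s] B] unfolding H_eq sets_P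
    by (simp add: vimage_def Int_def conj_commute)
  have cond: "AE \<omega> in P x. real_cond_exp (P x) G (indicator H) \<omega>
       = measure (P (X s \<omega>)) {\<omega>' \<in> space M. path_from X 0 \<omega>' \<in> B}"
    using strong_markov[OF st B, of x] s unfolding G_def H_def T_def by simp
  have iH: "integrable (P x) (indicator H :: _ \<Rightarrow> real)"
    using HM by (intro integrable_real_indicator) (simp_all add: Px.emeasure_eq_measure)
  have "c * measure (P x) A = (\<integral>\<omega>. indicator A \<omega> * c \<partial>P x)"
  proof -
    have "A \<inter> space (P x) = A"
      using AM by (auto simp: space_P)
    then show ?thesis
      by (simp only: Bochner_Integration.integral_mult_right_zero Bochner_Integration.integral_indicator mult.commute)
  qed
  also have "\<dots> \<le> (\<integral>\<omega>. indicator A \<omega> * real_cond_exp (P x) G (indicator H) \<omega> \<partial>P x)"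
  proof (rule integral_mono_AE)
    show "integrable (P x) (\<lambda>\<omega>. indicator A \<omega> * c)"
      using AM
      by (intro integrable_mult_left integrable_real_indicator) (simp_all add: sets_P Px.emeasure_eq_measure)
    show "integrable (P x) (\<lambda>\<omega>. indicator A \<omega> * real_cond_exp (P x) G (indicator H) \<omega>)"
      using AM real_cond_exp_int(1)[OF iH] by (subst mult.commute) (intro integrable_real_mult_indicator, auto simp: sets_P)
    show "AE \<omega> in P x. indicator A \<omega> * c \<le> indicator A \<omega> * real_cond_exp (P x) G (indicator H) \<omega>"
      using cond by eventually_elim (auto split: split_indicator intro: ge)
  qed
  also have "\<dots> = (\<integral>\<omega>. indicator A \<omega> * indicator H \<omega> \<partial>P x)"
    using real_cond_exp_intA[OF iH AG] by (simp add: set_lebesgue_integral_def)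
  also have "\<dots> = measure (P x) (A \<inter> H)"
  proof -
    have "(\<lambda>\<omega>. indicator A \<omega> * indicator H \<omega> :: real) = indicator (A \<inter> H)"
      by (auto simp: indicator_def)
    moreover have "A \<inter> H \<inter> space (P x) = A \<inter> H"
      using AM by (auto simp: space_P)
    ultimately show ?thesis
      by (simp only: Bochner_Integration.integral_indicator)
  qed
  also have "A \<inter> H = {\<omega> \<in> A. path_from X s \<omega> \<in> B}"
    unfolding H_eq using AM by auto
  finally show ?thesis .
qed

end

section \<open>The drift along a path\<close>

text \<open>The compensator in condition L, as a functional of a single path \<open>f = V(X)\<close>.\<close>

definition drift :: "(real \<Rightarrow> real) \<Rightarrow> real \<Rightarrow> real \<Rightarrow> (real \<Rightarrow> real) \<Rightarrow> real \<Rightarrow> real"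
  where "drift \<phi> b l f t =
    (LBINT u:{0..t}. \<phi> (1 / f u)) + b * (LBINT u:{0..t}. indicator {u. f u \<le> l} u)"

lemma drift_0: "drift \<phi> b l f 0 = 0"
proof -
  have "(LBINT u:{0..0::real}. g u) = 0" for g :: "real \<Rightarrow> real"
    unfolding set_lebesgue_integral_def
    using AE_lborel_singleton[of 0] by (intro integral_eq_zero_AE) (auto elim!: eventually_mono)
  then show ?thesis
    unfolding drift_def by (simp del: atLeastAtMost_singleton)
qed

text \<open>A single bounded measurable density \<open>w\<close> for the drift, from which all its bounds are read off.
  Right-continuity of \<open>f\<close> is known only at nonnegative times, hence the \<open>max 0 u\<close>; measurability of \<open>w\<close>
  comes from it and from continuity of \<open>\<phi>\<close>.\<close>

lemma drift_eq_integral: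
  fixes f \<phi> :: "real \<Rightarrow> real" and b l t :: real
  assumes \<phi>: "\<forall>s\<in>{0<..1}. 0 \<le> \<phi> s" "mono_on {0<..1} \<phi>" "continuous_on {0<..1} \<phi>"
    and b: "0 \<le> b" and f: "\<And>u. 1 \<le> f u" "\<forall>s\<ge>0. (f \<longlongrightarrow> f s) (at_right s)"
  defines "w \<equiv> \<lambda>u. \<phi> (1 / f (max 0 u)) + b * indicator {u. f (max 0 u) \<le> l} u"
  shows "\<And>u. 0 \<le> w u" "\<And>u. w u \<le> \<phi> 1 + b"
    "\<And>s t. set_integrable lborel {s<..t} w" "\<And>s t. set_integrable lborel {s..t} w"
    "drift \<phi> b l f t = (LBINT u:{0..t}. w u)"
proof -
  define \<psi> where "\<psi> y = \<phi> (1 / max 1 y)" for y :: real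
  have "continuous_on UNIV \<psi>"
    unfolding \<psi>_def
    by (rule continuous_on_compose2[OF \<phi>(3)]) (auto intro!: continuous_intros)
  then have [measurable]: "\<psi> \<in> borel_measurable borel"
    by (rule borel_measurable_continuous_onI)
  have [measurable]: "(\<lambda>u. f (max 0 u)) \<in> borel_measurable borel"
  proof (rule borel_measurable_right_continuous)
    show "((\<lambda>u. f (max 0 u)) \<longlongrightarrow> f (max 0 s)) (at_right s)" for s :: real
    proof (cases "0 \<le> s")
      case True
      have "eventually (\<lambda>u. f u = f (max 0 u)) (at_right s)"
        using True by (auto simp: eventually_at_right_field max_def intro!: exI[of _ "s + 1"])
      moreover have "(f \<longlongrightarrow> f (max 0 s)) (at_right s)"
        using f(2) True by simp
      ultimately show ?thesis
        by (rule Lim_transform_eventually[rotated])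
    next
      case False
      then have "eventually (\<lambda>u. f 0 = f (max 0 u)) (at_right s)"
        by (auto simp: eventually_at_right_field max_def intro!: exI[of _ 0])
      then have "((\<lambda>u. f (max 0 u)) \<longlongrightarrow> f 0) (at_right s)"
        by (rule Lim_transform_eventually[OF tendsto_const])
      then show ?thesis
        using False by (simp add: max_def)
    qed
  qed
  have \<phi>f: "\<phi> (1 / f (max 0 u)) = \<psi> (f (max 0 u))" for u
    using f(1) by (simp add: \<psi>_def)
  have range: "1 / f u \<in> {0<..1}" for u
    using f(1)[of u] by auto
  have m1: "(\<lambda>u. \<phi> (1 / f (max 0 u))) \<in> borel_measurable borel"
    unfolding \<phi>f by measurable
  have m2: "(\<lambda>u. indicator {u. f (max 0 u) \<le> l} u :: real) \<in> borel_measurable borel"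
    by measurable
  have bd1: "0 \<le> \<phi> (1 / f (max 0 u))" "\<phi> (1 / f (max 0 u)) \<le> \<phi> 1" for u
    using \<phi>(1) range mono_onD[OF \<phi>(2) range[of "max 0 u"], of 1] f(1)[of "max 0 u"] by auto
  show w0: "0 \<le> w u" and wK: "w u \<le> \<phi> 1 + b" for u
    unfolding w_def using bd1[of u] b by (auto simp: indicator_def)
  have [measurable]: "w \<in> borel_measurable borel"
    unfolding w_def using m1 m2 by simp
  have bdd: "set_integrable lborel A g"
    if "g \<in> borel_measurable borel" "\<And>u. \<bar>g u\<bar> \<le> K" "A = {s<..t} \<or> A = {s..t}" for A K s t and g :: "real \<Rightarrow> real"
    unfolding set_integrable_def
    using that emeasure_bounded_finite[of "{s<..t}"] emeasure_bounded_finite[of "{s..t}"]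
    by (intro integrableI_bounded_set_indicator[where B=K]) auto
  show "set_integrable lborel {s<..t} w" "set_integrable lborel {s..t} w" for s t
    by (rule bdd[where K="\<phi> 1 + b"], use w0 wK in auto)+
  have i1: "set_integrable lborel {0..t} (\<lambda>u. \<phi> (1 / f (max 0 u)))"
    by (rule bdd[where K="\<phi> 1"], use m1 bd1 in auto)
  have i2: "set_integrable lborel {0..t} (\<lambda>u. indicator {u. f (max 0 u) \<le> l} u :: real)"
    by (rule bdd[where K=1], use m2 in \<open>auto simp: indicator_def\<close>)
  have "drift \<phi> b l f t = (LBINT u:{0..t}. \<phi> (1 / f (max 0 u))) 
      + b * (LBINT u:{0..t}. indicator {u. f (max 0 u) \<le> l} u)"
    unfolding drift_def
    by (intro arg_cong2[where f="\<lambda>x y. x + b * y"] set_lebesgue_integral_cong) (auto simp: indicator_def)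
  also have "\<dots> = (LBINT u:{0..t}. w u)"
    unfolding w_def using i1 i2 by (simp add: set_integral_add(2))
  finally show "drift \<phi> b l f t = (LBINT u:{0..t}. w u)" .
qed

lemma drift_increment:
  assumes \<phi>: "\<forall>s\<in>{0<..1}. 0 \<le> \<phi> s" "mono_on {0<..1} \<phi>" "continuous_on {0<..1} \<phi>"
    and b: "0 \<le> b" and f: "\<And>u. 1 \<le> f u" "\<forall>s\<ge>0. (f \<longlongrightarrow> f s) (at_right s)"
    and st: "0 \<le> s" "s \<le> t"
  shows "drift \<phi> b l f s \<le> drift \<phi> b l f t"
    and "drift \<phi> b l f t \<le> drift \<phi> b l f s + (\<phi> 1 + b) * (t - s)"
proof -
  note D = drift_eq_integral[OF \<phi> b f, where l=l]
  define w where "w = (\<lambda>u. \<phi> (1 / f (max 0 u)) + b * indicator {u. f (max 0 u) \<le> l} u)"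
  have drift_w: "drift \<phi> b l f t = (LBINT u:{0..t}. w u)" for t
    unfolding w_def by (rule D(5))
  have eq: "{0..t} = {0..s} \<union> {s<..t}"
    using st by auto
  have "(LBINT u:{0..t}. w u) = (LBINT u:{0..s}. w u) + (LBINT u:{s<..t}. w u)"
    unfolding eq w_def using D by (intro set_integral_Un) auto
  then have *: "drift \<phi> b l f t = drift \<phi> b l f s + (LBINT u:{s<..t}. w u)"
    unfolding drift_w .
  have "(LBINT u:{s<..t}. w u) \<ge> 0"
    unfolding set_lebesgue_integral_def using D(1) by (intro Bochner_Integration.integral_nonneg) (auto simp: w_def)
  with * show "drift \<phi> b l f s \<le> drift \<phi> b l f t"
    by simp
  have "(LBINT u:{s<..t}. w u) \<le> (LBINT u:{s<..t}. (\<phi> 1 + b))"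
    using D(2,3) emeasure_bounded_finite[of "{s<..t}"] unfolding w_def
    by (intro set_integral_mono) (auto simp: set_integrable_def)
  also have "\<dots> = (\<phi> 1 + b) * (t - s)"
    using st by (simp add: set_lebesgue_integral_def)
  finally show "drift \<phi> b l f t \<le> drift \<phi> b l f s + (\<phi> 1 + b) * (t - s)"
    using * by simp
qed

text \<open>Above the level \<open>l\<close> only \<open>\<phi>\<close> contributes, and \<open>\<phi>\<close> is monotone. The path may already be below
  \<open>v\<close> at the end point \<open>t\<close>, which is a null set; this matters at the first passage time.\<close>

lemma drift_le_above:
  assumes \<phi>: "\<forall>s\<in>{0<..1}. 0 \<le> \<phi> s" "mono_on {0<..1} \<phi>" "continuous_on {0<..1} \<phi>"
    and b: "0 \<le> b" and f: "\<And>u. 1 \<le> f u" "\<forall>s\<ge>0. (f \<longlongrightarrow> f s) (at_right s)"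
    and t: "0 \<le> t" and v: "1 \<le> v" "l < v" and above: "\<And>u. 0 \<le> u \<Longrightarrow> u < t \<Longrightarrow> v \<le> f u"
  shows "drift \<phi> b l f t \<le> t * \<phi> (1 / v)"
proof -
  note D = drift_eq_integral[OF \<phi> b f, where l=l]
  define w where "w = (\<lambda>u. \<phi> (1 / f (max 0 u)) + b * indicator {u. f (max 0 u) \<le> l} u)"
  have drift_w: "drift \<phi> b l f t = (LBINT u:{0..t}. w u)" for t
    unfolding w_def by (rule D(5))
  have le: "w u \<le> \<phi> (1 / v)" if "0 \<le> u" "u < t" for u
  proof -
    have "\<phi> (1 / f u) \<le> \<phi> (1 / v)"
      using v above[OF that] f(1)[of u] by (intro mono_onD[OF \<phi>(2)]) (auto simp: frac_le)
    then show ?thesis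
      using v above[OF that] that by (simp add: w_def max_def)
  qed
  have "(LBINT u:{0..t}. w u) \<le> (LBINT u:{0..t}. \<phi> (1 / v))"
  proof (rule set_integral_mono_AE)
    show "set_integrable lborel {0..t} w"
      using D(4) by (simp add: w_def)
    show "set_integrable lborel {0..t} (\<lambda>_. \<phi> (1 / v))"
      using emeasure_bounded_finite[of "{0..t}"] by (simp add: set_integrable_def)
    show "AE u\<in>{0..t} in lborel. w u \<le> \<phi> (1 / v)"
      using AE_lborel_singleton[of t] by eventually_elim (auto intro: le)
  qed
  also have "\<dots> = t * \<phi> (1 / v)"
    using t by (simp add: set_lebesgue_integral_def)
  finally show ?thesis
    unfolding drift_w .
qed

section \<open>First passage on a grid\<close>

definition grid :: "real \<Rightarrow> nat \<Rightarrow> nat \<Rightarrow> real"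
  where "grid t n i = real i * t / real (Suc n)"

text \<open>The index of the first grid point at which \<open>f\<close> is below \<open>v\<close>, and the last index \<open>n + 1\<close> if there
  is none.\<close>

definition first_below :: "(real \<Rightarrow> real) \<Rightarrow> real \<Rightarrow> real \<Rightarrow> nat \<Rightarrow> nat"
  where "first_below f v t n = (LEAST i. i = Suc n \<or> f (grid t n i) < v)"

lemma grid_0: "grid t n 0 = 0" and grid_last: "grid t n (Suc n) = t"
  by (simp_all add: grid_def del: of_nat_Suc)

lemma mono_grid: "0 \<le> t \<Longrightarrow> mono (grid t n)"
  unfolding grid_def by (intro monoI divide_right_mono mult_right_mono) auto

lemma first_below_le: "first_below f v t n \<le> Suc n"
  unfolding first_below_def by (rule Least_le) simp

lemma first_below_cases:
  "first_below f v t n = Suc n \<or> f (grid t n (first_below f v t n)) < v"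
  unfolding first_below_def by (rule LeastI) blast

lemma first_below_gt_iff:
  assumes "i < Suc n"
  shows "i < first_below f v t n \<longleftrightarrow> (\<forall>j\<le>i. v \<le> f (grid t n j))"
proof
  show "i < first_below f v t n \<Longrightarrow> \<forall>j\<le>i. v \<le> f (grid t n j)"
    unfolding first_below_def by (metis (mono_tags, lifting) le_less_trans not_less_Least not_le)
  show "\<forall>j\<le>i. v \<le> f (grid t n j) \<Longrightarrow> i < first_below f v t n"
    using first_below_cases[of f v t n] assms by (metis not_le)
qed

text \<open>Writes the value at the first grid passage in the form to which
  \<open>supermartingale_discrete_stopping\<close> applies.\<close>

lemma telescope_first_below:
  fixes y :: "real \<Rightarrow> real"
  shows "y (grid t n 0) + (\<Sum>i<Suc n. of_bool (\<forall>j\<le>i. v \<le> f (grid t n j)) * (y (grid t n (Suc i)) - y (grid t n i)))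
    = y (grid t n (first_below f v t n))"
proof -
  let ?k = "first_below f v t n"
  have "(\<Sum>i<Suc n. of_bool (\<forall>j\<le>i. v \<le> f (grid t n j)) * (y (grid t n (Suc i)) - y (grid t n i)))
    = (\<Sum>i<Suc n. if i \<in> {..<?k} then y (grid t n (Suc i)) - y (grid t n i) else 0)"
    by (intro sum.cong refl) (simp add: first_below_gt_iff)
  also have "\<dots> = (\<Sum>i<?k. y (grid t n (Suc i)) - y (grid t n i))"
    using first_below_le[of f v t n] by (subst sum.inter_restrict[symmetric]) (auto intro!: sum.cong)
  also have "\<dots> = y (grid t n ?k) - y (grid t n 0)"
    by (rule sum_lessThan_telescope)
  finally show ?thesis
    by simp
qed

lemma grid_between:
  assumes "0 \<le> s" and "s < e" and "e \<le> t"
  shows "\<forall>\<^sub>F n in sequentially. \<exists>i<Suc n. s < grid t n i \<and> grid t n i < e"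
proof -
  have t: "0 < t"
    using assms by simp
  have "(\<lambda>n. t * (1 / real (Suc n))) \<longlonglongrightarrow> t * 0"
    by (intro tendsto_intros LIMSEQ_Suc[OF lim_1_over_n])
  then have "\<forall>\<^sub>F n in sequentially. t * (1 / real (Suc n)) < e - s"
    by (rule order_tendstoD(2)) (use assms in auto)
  then show ?thesis
  proof eventually_elim
    case (elim n)
    define N where "N = real (Suc n)"
    define i where "i = nat (\<lfloor>s * N / t\<rfloor> + 1)"
    have N: "0 < N"
      by (simp add: N_def)
    have "0 \<le> s * N / t"
      using assms t N by auto
    then have i: "s * N / t < real i" "real i \<le> s * N / t + 1"
      unfolding i_def by linarith+
    have "s < real i * t / N"
      using i(1) t N by (simp add: field_simps)
    moreover have "real i * t \<le> s * N + t"
      using mult_right_mono[OF i(2), of t] t by (simp add: distrib_right)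
    then have "real i * t / N \<le> s + t / N"
      using N by (simp add: field_simps)
    moreover have "t / N < e - s"
      using elim by (simp add: N_def)
    ultimately have *: "s < grid t n i" "grid t n i < e"
      unfolding grid_def N_def by linarith+
    then have "grid t n i < grid t n (Suc n)"
      using assms by (simp add: grid_last)
    then have "i < Suc n"
      using monoD[OF mono_grid[of t n], of "Suc n" i] t by (metis less_imp_le not_le)
    with * show ?case
      by blast
  qed
qed

text \<open>Passage below \<open>v\<close> at some time before \<open>t\<close> persists to the right of that time by
  right-continuity, and is therefore seen by all sufficiently fine grids. So the grid passages
  converge to \<open>S\<close>, the first passage time capped at \<open>t\<close>, and the grids eventually decide whether there
  is a passage in \<open>{0..t}\<close>; at \<open>t\<close> itself they do so because \<open>t\<close> is a grid point.\<close>

lemma grid_passage_converges: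
  fixes f :: "real \<Rightarrow> real"
  assumes t: "0 \<le> t" and f: "\<forall>s\<ge>0. (f \<longlongrightarrow> f s) (at_right s)"
  obtains S where "0 \<le> S" "S \<le> t" "\<And>u. 0 \<le> u \<Longrightarrow> u < S \<Longrightarrow> v \<le> f u"
    "(\<lambda>n. grid t n (first_below f v t n)) \<longlonglongrightarrow> S"
    "(\<lambda>n. of_bool (f (grid t n (first_below f v t n)) < v) :: real) \<longlonglongrightarrow> of_bool (\<exists>s\<in>{0..t}. f s < v)"
proof -
  define s where "s n = grid t n (first_below f v t n)" for n
  define H where "H = {u \<in> {0..t}. f u < v} \<union> {t}"
  define S where "S = Inf H"
  have H: "H \<noteq> {}" "bdd_below H" "H \<subseteq> {0..t}"
    using t by (auto simp: H_def bdd_below_def)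
  have s_range: "s n \<in> {0..t}" for n
    using monoD[OF mono_grid[OF t], of 0 "first_below f v t n" n]
      monoD[OF mono_grid[OF t] first_below_le, of n f v t n] 
    by (simp add: s_def grid_0 grid_last)
  have s_H: "s n \<in> H" for n
    using s_range[of n] first_below_cases[of f v t n] by (auto simp: H_def s_def grid_last)
  have soon: "\<forall>\<^sub>F n in sequentially. s n < e \<and> f (s n) < v" if u: "0 \<le> u" "u < t" "f u < v" "u < e" for u e
  proof -
    have "\<forall>\<^sub>F x in at_right u. f x < v"
      using f[rule_format, OF u(1)] u(3) by (rule order_tendstoD(2))
    then obtain b where b: "b > u" "\<And>y. u < y \<Longrightarrow> y < b \<Longrightarrow> f y < v"
      unfolding eventually_at_right_field by blast
    have "\<forall>\<^sub>F n in sequentially. \<exists>i<Suc n. u < grid t n i \<and> grid t n i < min (min b e) t"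
      by (rule grid_between) (use u b in auto)
    then show ?thesis
    proof eventually_elim
      case (elim n)
      then obtain i where i: "i < Suc n" "u < grid t n i" "grid t n i < b" "grid t n i < e"
        by auto
      have "first_below f v t n \<le> i"
        unfolding first_below_def using b(2) i by (intro Least_le) auto
      then show ?case
        using first_below_cases[of f v t n] i monoD[OF mono_grid[OF t], of "first_below f v t n" i n]
        by (auto simp: s_def)
    qed
  qed
  show thesis
  proof
    show "0 \<le> S" "S \<le> t"
      unfolding S_def using H by (auto intro!: cInf_greatest cInf_lower simp: H_def)
    show "v \<le> f u" if "0 \<le> u" "u < S" for u
    proof (rule ccontr)
      assume "\<not> v \<le> f u"
      then have "u \<in> H"
        using that \<open>S \<le> t\<close> by (auto simp: H_def)
      then show False
        using cInf_lower[OF _ H(2), of u] that by (simp add: S_def)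
    qed
    have lower: "S \<le> s n" for n
      unfolding S_def by (rule cInf_lower[OF s_H H(2)])
    have "s \<longlonglongrightarrow> S"
    proof (rule order_tendstoI)
      show "\<forall>\<^sub>F n in sequentially. a < s n" if "a < S" for a
        using that lower by (auto intro!: always_eventually simp: less_le_trans)
      show "\<forall>\<^sub>F n in sequentially. s n < e" if "S < e" for e
      proof (cases "S = t")
        case True
        then have "s n < e" for n
          using that s_range[of n] by simp
        then show ?thesis
          by simp
      next
        case False
        then have "Inf H < min e t"
          using that \<open>S \<le> t\<close> by (simp add: S_def)
        then obtain u where "u \<in> H" "u < min e t"
          using H cInf_less_iff[of H "min e t"] by blast
        then have "\<forall>\<^sub>F n in sequentially. s n < e \<and> f (s n) < v"
          by (intro soon[of u]) (auto simp: H_def)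
        then show ?thesis
          by eventually_elim simp
      qed
    qed
    then show "(\<lambda>n. grid t n (first_below f v t n)) \<longlonglongrightarrow> S"
      by (simp add: s_def[abs_def])
    have "\<forall>\<^sub>F n in sequentially. (f (s n) < v) = (\<exists>s\<in>{0..t}. f s < v)"
    proof (cases "\<exists>u\<in>{0..<t}. f u < v")
      case True
      then obtain u where "0 \<le> u" "u < t" "f u < v"
        by auto
      then have "\<forall>\<^sub>F n in sequentially. s n < u + 1 \<and> f (s n) < v"
        by (intro soon) auto
      then show ?thesis
        by eventually_elim (use s_range in blast)
    next
      case False
      have "(f (s n) < v) = (\<exists>s\<in>{0..t}. f s < v)" for n
      proof
        show "f (s n) < v" if "\<exists>s\<in>{0..t}. f s < v"
        proof -
          have "f t < v"
            using that False by (metis atLeastAtMost_iff atLeastLessThan_iff le_less)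
          then show ?thesis
            using first_below_cases[of f v t n] by (auto simp: s_def grid_last)
        qed
      qed (use s_range in blast)
      then show ?thesis
        by simp
    qed
    then have "\<forall>\<^sub>F n in sequentially. of_bool (f (s n) < v) = (of_bool (\<exists>s\<in>{0..t}. f s < v) :: real)"
      by eventually_elim simp
    then show "(\<lambda>n. of_bool (f (grid t n (first_below f v t n)) < v) :: real) \<longlonglongrightarrow> of_bool (\<exists>s\<in>{0..t}. f s < v)"
      unfolding s_def by (rule tendsto_eventually)
  qed
qed

section \<open>Staying at high levels\<close>

context strong_markov_process
begin

text \<open>The event of staying above \<open>v\<close> up to time \<open>t\<close>, expressed by countably many coordinates so that it
  is measurable in the product sigma-algebra. The end point \<open>t\<close> is listed separately because
  no rational times of the interval lie to its right.\<close>

definition stay_paths :: "('x \<Rightarrow> real) \<Rightarrow> real \<Rightarrow> real \<Rightarrow> (real \<Rightarrow> 'x) set"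
  where "stay_paths V v t = {p \<in> space path_space. \<forall>u\<in>(\<rat> \<inter> {0..t}) \<union> {t}. v \<le> V (p u)}"

lemma right_continuous_V:
  assumes "continuous_on UNIV V" and "\<omega> \<in> space M"
  shows "\<forall>s\<ge>0. ((\<lambda>u. V (X u \<omega>)) \<longlongrightarrow> (V (X s \<omega>) :: real)) (at_right s)"
proof (intro allI impI)
  fix s :: real assume "0 \<le> s"
  then have "((\<lambda>u. X u \<omega>) \<longlongrightarrow> X s \<omega>) (at_right s)"
    using cadlag_paths[OF assms(2)] by (simp add: cadlag_def)
  moreover have "isCont V (X s \<omega>)"
    using assms(1) by (simp add: continuous_on_eq_continuous_at)
  ultimately show "((\<lambda>u. V (X u \<omega>)) \<longlongrightarrow> V (X s \<omega>)) (at_right s)"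
    by (rule isCont_tendsto_compose[rotated])
qed

lemma measurable_V_X:
  fixes V :: "'x \<Rightarrow> real"
  assumes "continuous_on UNIV V" and "0 \<le> u" and "u \<le> s"
  shows "(\<lambda>\<omega>. V (X u \<omega>)) \<in> borel_measurable (F s)"
  using measurable_compose[OF measurable_X_later[OF assms(2,3)] borel_measurable_continuous_onI[OF assms(1)]] .

lemma measurable_V_X':
  fixes V :: "'x \<Rightarrow> real"
  assumes "continuous_on UNIV V" and "0 \<le> u"
  shows "(\<lambda>\<omega>. V (X u \<omega>)) \<in> borel_measurable M"
  using measurable_compose[OF measurable_X[OF assms(2)] borel_measurable_continuous_onI[OF assms(1)]] .

lemma sets_stay_paths:
  fixes V :: "'x \<Rightarrow> real"
  assumes "continuous_on UNIV V" and "0 \<le> t"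
  shows "stay_paths V v t \<in> sets path_space"
proof -
  have [measurable]: "V \<in> borel_measurable borel"
    using assms(1) by (rule borel_measurable_continuous_onI)
  have "countable ((\<rat> \<inter> {0..t}) \<union> {t})"
    using countable_rat by auto
  moreover have "{p \<in> space path_space. v \<le> V (p u)} \<in> sets path_space" if "u \<in> (\<rat> \<inter> {0..t}) \<union> {t}" for u
  proof -
    have "(\<lambda>p. p u) \<in> path_space \<rightarrow>\<^sub>M (borel :: 'x measure)"
      unfolding path_space_def using that assms(2) by (intro measurable_component_singleton) auto
    then show ?thesis
      by measurable
  qed
  ultimately show ?thesis
    unfolding stay_paths_def by (intro sets.sets_Collect_countable_All')
qed

lemma path_from_stay_paths:
  fixes V :: "'x \<Rightarrow> real"
  assumes V: "continuous_on UNIV V" and \<omega>: "\<omega> \<in> space M" and s: "0 \<le> s" and t: "0 \<le> t"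
  shows "path_from X s \<omega> \<in> stay_paths V v t \<longleftrightarrow> (\<forall>u\<in>{s..s + t}. v \<le> V (X u \<omega>))"
proof
  have space: "path_from X s \<omega> \<in> space path_space"
    using measurable_space[OF measurable_path_from[OF s] \<omega>] .
  show "path_from X s \<omega> \<in> stay_paths V v t" if *: "\<forall>u\<in>{s..s + t}. v \<le> V (X u \<omega>)"
    unfolding stay_paths_def using space * t by (auto simp: path_from_def)
  assume stay: "path_from X s \<omega> \<in> stay_paths V v t"
  have at: "v \<le> V (X (s + u) \<omega>)" if "u \<in> (\<rat> \<inter> {0..t}) \<union> {t}" for u
    using stay that t by (auto simp: stay_paths_def path_from_def)
  show "\<forall>u\<in>{s..s + t}. v \<le> V (X u \<omega>)"
  proof
    fix u assume u: "u \<in> {s..s + t}"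
    show "v \<le> V (X u \<omega>)"
    proof (cases "u = s + t")
      case True
      then show ?thesis
        using at[of t] by simp
    next
      case False
      have "((\<lambda>w. V (X (s + w) \<omega>)) \<longlongrightarrow> V (X (s + (u - s)) \<omega>)) (at_right (u - s))"
        using right_continuous_V[OF V \<omega>, rule_format, of u] u s
        by (simp add: filterlim_at_right_to_0[of _ _ u] filterlim_at_right_to_0[of _ _ "u - s"] algebra_simps)
      then have "v \<le> V (X (s + (u - s)) \<omega>)"
        by (rule right_continuous_ge[where e=t]) (use u False in \<open>auto intro: at\<close>)
      then show ?thesis
        by simp
    qed
  qed
qed

text \<open>Markov's inequality for \<open>1 / V(X)\<close> at the first passage below \<open>v\<close>, capped at \<open>t\<close>: its mean is at
  most \<open>1 / V y\<close> plus the mean drift up to that time. On a grid the drift may include times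
  at which \<open>V\<close> has already dipped below \<open>v\<close> between grid points, and the bound
  \<open>t * \<phi> (1 / v)\<close> holds only in the limit of vanishing mesh.\<close>

lemma stay_probability:
  fixes V :: "'x \<Rightarrow> real"
  assumes V: "continuous_on UNIV V" "\<And>x. 1 \<le> V x"
    and \<phi>: "\<forall>s\<in>{0<..1}. 0 \<le> \<phi> s" "mono_on {0<..1} \<phi>" "continuous_on {0<..1} \<phi>" and b: "0 \<le> b"
    and super: "supermartingale (P y) F (\<lambda>t \<omega>. 1 / V (X t \<omega>) - drift \<phi> b l (\<lambda>u. V (X u \<omega>)) t)"
    and v: "1 \<le> v" "l < v" and t: "0 \<le> t"
  shows "1 - (v / V y + v * (t * \<phi> (1 / v)))
    \<le> measure (P y) {\<omega> \<in> space M. path_from X 0 \<omega> \<in> stay_paths V v t}"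
proof -
  interpret Py: prob_space "P y" by (rule prob_space_P)
  define W where "W = (\<lambda>t \<omega>. drift \<phi> b l (\<lambda>u. V (X u \<omega>)) t)"
  define Z where "Z = (\<lambda>t \<omega>. 1 / V (X t \<omega>) - W t \<omega>)"
  define \<sigma> where "\<sigma> n \<omega> = grid t n (first_below (\<lambda>u. V (X u \<omega>)) v t n)" for n \<omega>
  define A where "A n i = {\<omega> \<in> space M. \<forall>j\<le>i. v \<le> V (X (grid t n j) \<omega>)}" for n i
  define K where "K = \<phi> 1 + b"
  have K: "0 \<le> K"
    using \<phi>(1) b by (simp add: K_def)
  have Z: "supermartingale (P y) F Z"
    using super unfolding Z_def W_def .
  have grid0: "0 \<le> grid t n i" for n i
    using monoD[OF mono_grid[OF t], of 0 i n] by (simp add: grid_0)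
  have W_mono: "W s \<omega> \<le> W s' \<omega>" "W s' \<omega> \<le> W s \<omega> + K * (s' - s)"
    if "\<omega> \<in> space M" "0 \<le> s" "s \<le> s'" for s s' \<omega>
    using drift_increment[OF \<phi> b V(2) right_continuous_V[OF V(1) that(1)] that(2,3)]
    by (auto simp: W_def K_def)
  have W_0: "W 0 \<omega> = 0" for \<omega>
    by (simp add: W_def drift_0)
  have \<sigma>_range: "0 \<le> \<sigma> n \<omega>" "\<sigma> n \<omega> \<le> t" for n \<omega>
    using grid0 monoD[OF mono_grid[OF t] first_below_le[of "\<lambda>u. V (X u \<omega>)" v t n], of n]
    by (simp_all add: \<sigma>_def grid_last)
  have A_sets: "A n i \<in> sets (F (grid t n i))" for n i
  proof -
    have space: "space (F (grid t n i)) = space M"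
      using subalgebra_F[OF grid0] by (simp add: subalgebra_def)
    have "(\<lambda>\<omega>. V (X (grid t n j) \<omega>)) \<in> borel_measurable (F (grid t n i))" if "j \<le> i" for j
      using measurable_V_X[OF V(1) grid0 monoD[OF mono_grid[OF t] that]] .
    then have "Measurable.pred (F (grid t n i)) (\<lambda>\<omega>. \<forall>j\<in>{..i}. v \<le> V (X (grid t n j) \<omega>))"
      by (intro pred_intros_finite) auto
    then show ?thesis
      by (simp only: pred_def space A_def Ball_def atMost_iff)
  qed
  have stop: "Y (grid t n 0) \<omega> + (\<Sum>i<Suc n. indicator (A n i) \<omega> * (Y (grid t n (Suc i)) \<omega> - Y (grid t n i) \<omega>))
      = Y (\<sigma> n \<omega>) \<omega>" if "\<omega> \<in> space M" for n \<omega> and Y :: "real \<Rightarrow> 'w \<Rightarrow> real"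
  proof -
    have "of_bool (\<forall>j\<le>i. v \<le> V (X (grid t n j) \<omega>)) = (indicator (A n i) \<omega> :: real)" for i
      using that by (simp add: A_def)
    then show ?thesis
      using telescope_first_below[of "\<lambda>u. Y u \<omega>" t n v "\<lambda>u. V (X u \<omega>)"]
      by (simp only: \<sigma>_def)
  qed
  have A_P: "A n i \<in> sets (P y)" for n i
    using A_sets[of n i] subalgebra_P[OF grid0[of n i], of y] by (auto simp: subalgebra_def)
  have meas_stop: "(\<lambda>\<omega>. Y (\<sigma> n \<omega>) \<omega>) \<in> borel_measurable (P y)"
    if "\<And>u. 0 \<le> u \<Longrightarrow> Y u \<in> borel_measurable (P y)" for Y :: "real \<Rightarrow> 'w \<Rightarrow> real" and n
  proof -
    have "(\<lambda>\<omega>. Y (grid t n 0) \<omega> + (\<Sum>i<Suc n. indicator (A n i) \<omega> * (Y (grid t n (Suc i)) \<omega> - Y (grid t n i) \<omega>)))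
        \<in> borel_measurable (P y)"
      using A_P that grid0 by (intro borel_measurable_add borel_measurable_sum borel_measurable_times
          borel_measurable_indicator borel_measurable_diff) auto
    then show ?thesis
      by (rule measurable_cong[THEN iffD1, rotated]) (rule stop, simp add: space_P)
  qed
  have V_meas: "(\<lambda>\<omega>. V (X u \<omega>)) \<in> borel_measurable (P y)" if "0 \<le> u" for u
    using measurable_V_X'[OF V(1) that] measurable_cong_sets[OF sets_P refl] by blast
  have Z_int: "integrable (P y) (Z u)" if "0 \<le> u" for u
    using Z that by (auto simp: supermartingale_def)
  have V_\<sigma>: "(\<lambda>\<omega>. V (X (\<sigma> n \<omega>) \<omega>)) \<in> borel_measurable (P y)" for n
    by (rule meas_stop) (rule V_meas)
  have Z_\<sigma>: "integrable (P y) (\<lambda>\<omega>. Z (\<sigma> n \<omega>) \<omega>)" "(\<integral>\<omega>. Z (\<sigma> n \<omega>) \<omega> \<partial>P y) \<le> 1 / V y" for n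
  proof -
    define R where "R = (\<lambda>\<omega>. Z (grid t n 0) \<omega>
      + (\<Sum>i<Suc n. indicator (A n i) \<omega> * (Z (grid t n (Suc i)) \<omega> - Z (grid t n i) \<omega>)))"
    have R: "integrable (P y) R" "(\<integral>\<omega>. R \<omega> \<partial>P y) \<le> (\<integral>\<omega>. Z (grid t n 0) \<omega> \<partial>P y)"
      unfolding R_def
      by (rule supermartingale_discrete_stopping[OF Py.finite_measure_axioms subalgebra_P[OF grid0]
            Z grid0 mono_grid[OF t] A_sets])+
    have cong: "Z (\<sigma> n \<omega>) \<omega> = R \<omega>" if "\<omega> \<in> space (P y)" for \<omega>
      using stop[of \<omega> Z n] that unfolding R_def by (simp only: space_P)
    have "integrable (P y) (\<lambda>\<omega>. Z (\<sigma> n \<omega>) \<omega>) = integrable (P y) R"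
      by (intro Bochner_Integration.integrable_cong refl cong)
    then show "integrable (P y) (\<lambda>\<omega>. Z (\<sigma> n \<omega>) \<omega>)"
      using R(1) by (simp only:)
    have "(\<integral>\<omega>. Z (\<sigma> n \<omega>) \<omega> \<partial>P y) = (\<integral>\<omega>. R \<omega> \<partial>P y)"
      by (intro Bochner_Integration.integral_cong refl cong)
    also have "\<dots> \<le> (\<integral>\<omega>. Z (grid t n 0) \<omega> \<partial>P y)"
      by (rule R(2))
    also have "\<dots> = (\<integral>\<omega>. 1 / V y \<partial>P y)"
    proof (rule integral_cong_AE)
      show "AE \<omega> in P y. Z (grid t n 0) \<omega> = 1 / V y"
        using start[of y] by eventually_elim (simp add: grid_0 Z_def W_0)
    qed (use Z_int[of 0] in \<open>auto simp: grid_0\<close>)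
    also have "\<dots> = 1 / V y"
      by (simp add: Py.prob_space)
    finally show "(\<integral>\<omega>. Z (\<sigma> n \<omega>) \<omega> \<partial>P y) \<le> 1 / V y" .
  qed
  \<comment> \<open>Measurability of the drift comes from that of \<open>Z\<close>, which is part of the supermartingale
    property.\<close>
  have W_\<sigma>_meas: "(\<lambda>\<omega>. W (\<sigma> n \<omega>) \<omega>) \<in> borel_measurable (P y)" for n
  proof -
    have "(\<lambda>\<omega>. 1 / V (X (\<sigma> n \<omega>) \<omega>) - Z (\<sigma> n \<omega>) \<omega>) \<in> borel_measurable (P y)"
      using V_\<sigma> borel_measurable_integrable[OF Z_\<sigma>(1)] by measurable
    then show ?thesis
      by (simp add: Z_def)
  qed
  define hit where "hit \<omega> \<longleftrightarrow> (\<exists>s\<in>{0..t}. V (X s \<omega>) < v)" for \<omega>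
  \<comment> \<open>\<open>U n\<close> is at most \<open>v\<close> times the stopped supermartingale, so its mean is at most \<open>v / V y\<close>.
    It is formed because it converges boundedly, to a limit that dominates
    the indicator of \<open>hit\<close> minus \<open>v * (t * \<phi> (1 / v))\<close>.\<close>
  define U where "U n \<omega> = of_bool (V (X (\<sigma> n \<omega>) \<omega>) < v) - v * W (\<sigma> n \<omega>) \<omega>" for n \<omega>
  have U_meas: "U n \<in> borel_measurable (P y)" for n
    unfolding U_def using V_\<sigma>[of n] W_\<sigma>_meas[of n] by measurable
  have W_bound: "0 \<le> W (\<sigma> n \<omega>) \<omega>" "W (\<sigma> n \<omega>) \<omega> \<le> K * t" if "\<omega> \<in> space M" for n \<omega>
    using W_mono[OF that, of 0 "\<sigma> n \<omega>"] \<sigma>_range[of n \<omega>] mult_left_mono[OF \<sigma>_range(2)[of n \<omega>] K] by (auto simp: W_0)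
  have U_bound: "\<bar>U n \<omega>\<bar> \<le> 1 + v * (K * t)" if "\<omega> \<in> space M" for n \<omega>
  proof -
    have "0 \<le> v * W (\<sigma> n \<omega>) \<omega>" "v * W (\<sigma> n \<omega>) \<omega> \<le> v * (K * t)"
      using W_bound[OF that] v by (auto intro!: mult_left_mono)
    then show ?thesis
      unfolding U_def by (cases "V (X (\<sigma> n \<omega>) \<omega>) < v") auto
  qed
  have U_int: "integrable (P y) (U n)" for n
    by (rule Py.integrable_const_bound[OF _ U_meas, where B="1 + v * (K * t)"])
       (use U_bound in \<open>auto simp: space_P intro!: AE_I2\<close>)
  have U_le: "(\<integral>\<omega>. U n \<omega> \<partial>P y) \<le> v / V y" for n
  proof -
    have "(\<integral>\<omega>. U n \<omega> \<partial>P y) \<le> (\<integral>\<omega>. v * Z (\<sigma> n \<omega>) \<omega> \<partial>P y)"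
    proof (rule integral_mono[OF U_int])
      show "integrable (P y) (\<lambda>\<omega>. v * Z (\<sigma> n \<omega>) \<omega>)"
        using Z_\<sigma>(1) by simp
      show "U n \<omega> \<le> v * Z (\<sigma> n \<omega>) \<omega>" for \<omega>
      proof -
        have "of_bool (V (X (\<sigma> n \<omega>) \<omega>) < v) \<le> v * (1 / V (X (\<sigma> n \<omega>) \<omega>))"
          using V(2)[of "X (\<sigma> n \<omega>) \<omega>"] v by (auto simp: of_bool_def field_simps)
        then show ?thesis
          by (simp add: U_def Z_def right_diff_distrib)
      qed
    qed
    also have "\<dots> = v * (\<integral>\<omega>. Z (\<sigma> n \<omega>) \<omega> \<partial>P y)"
      by simp
    also have "\<dots> \<le> v * (1 / V y)"
      using Z_\<sigma>(2) v by (intro mult_left_mono) auto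
    finally show ?thesis
      by simp
  qed
  have limit: "\<exists>u. (\<lambda>n. U n \<omega>) \<longlonglongrightarrow> u \<and> of_bool (hit \<omega>) - v * (t * \<phi> (1 / v)) \<le> u"
    if \<omega>: "\<omega> \<in> space M" for \<omega>
  proof -
    obtain S where S: "0 \<le> S" "S \<le> t" "\<And>u. 0 \<le> u \<Longrightarrow> u < S \<Longrightarrow> v \<le> V (X u \<omega>)"
      "(\<lambda>n. \<sigma> n \<omega>) \<longlonglongrightarrow> S" "(\<lambda>n. of_bool (V (X (\<sigma> n \<omega>) \<omega>) < v) :: real) \<longlonglongrightarrow> of_bool (hit \<omega>)"
      using grid_passage_converges[OF t right_continuous_V[OF V(1) \<omega>], of v thesis] unfolding \<sigma>_def hit_def by blast
    have lip: "\<bar>W (\<sigma> n \<omega>) \<omega> - W S \<omega>\<bar> \<le> K * \<bar>\<sigma> n \<omega> - S\<bar>" for n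
      using W_mono[OF \<omega>, of S "\<sigma> n \<omega>"] W_mono[OF \<omega>, of "\<sigma> n \<omega>" S] S(1) \<sigma>_range[of n \<omega>]
      by (cases "S \<le> \<sigma> n \<omega>") auto
    have "(\<lambda>n. W (\<sigma> n \<omega>) \<omega>) \<longlonglongrightarrow> W S \<omega>"
    proof (rule tendsto_sandwich)
      show "\<forall>\<^sub>F n in sequentially. W S \<omega> - K * \<bar>\<sigma> n \<omega> - S\<bar> \<le> W (\<sigma> n \<omega>) \<omega>"
        and "\<forall>\<^sub>F n in sequentially. W (\<sigma> n \<omega>) \<omega> \<le> W S \<omega> + K * \<bar>\<sigma> n \<omega> - S\<bar>"
        using lip by (auto simp: abs_le_iff algebra_simps intro!: always_eventually)
      have "(\<lambda>n. W S \<omega> - K * \<bar>\<sigma> n \<omega> - S\<bar>) \<longlonglongrightarrow> W S \<omega> - K * \<bar>S - S\<bar>"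
        by (intro tendsto_intros S)
      then show "(\<lambda>n. W S \<omega> - K * \<bar>\<sigma> n \<omega> - S\<bar>) \<longlonglongrightarrow> W S \<omega>"
        by simp
      have "(\<lambda>n. W S \<omega> + K * \<bar>\<sigma> n \<omega> - S\<bar>) \<longlonglongrightarrow> W S \<omega> + K * \<bar>S - S\<bar>"
        by (intro tendsto_intros S)
      then show "(\<lambda>n. W S \<omega> + K * \<bar>\<sigma> n \<omega> - S\<bar>) \<longlonglongrightarrow> W S \<omega>"
        by simp
    qed
    then have "(\<lambda>n. U n \<omega>) \<longlonglongrightarrow> of_bool (hit \<omega>) - v * W S \<omega>"
      unfolding U_def using S(5) by (intro tendsto_intros)
    moreover have "W S \<omega> \<le> t * \<phi> (1 / v)"
    proof -
      have "W S \<omega> \<le> S * \<phi> (1 / v)"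
        unfolding W_def
        using drift_le_above[OF \<phi> b V(2) right_continuous_V[OF V(1) \<omega>] S(1) v S(3)] .
      also have "\<dots> \<le> t * \<phi> (1 / v)"
        using S(2) \<phi>(1) v by (intro mult_right_mono) auto
      finally show ?thesis .
    qed
    then have "v * W S \<omega> \<le> v * (t * \<phi> (1 / v))"
      using v by (intro mult_left_mono) auto
    ultimately show ?thesis
      by (intro exI[of _ "of_bool (hit \<omega>) - v * W S \<omega>"]) auto
  qed
  define G where "G \<omega> = lim (\<lambda>n. U n \<omega>)" for \<omega>
  have G: "(\<lambda>n. U n \<omega>) \<longlonglongrightarrow> G \<omega>" "of_bool (hit \<omega>) - v * (t * \<phi> (1 / v)) \<le> G \<omega>" if "\<omega> \<in> space M" for \<omega>
    using limit[OF that] unfolding G_def by (metis limI)+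
  have G_meas: "G \<in> borel_measurable (P y)"
  proof (rule borel_measurable_LIMSEQ_real)
    show "(\<lambda>n. U n \<omega>) \<longlonglongrightarrow> G \<omega>" if "\<omega> \<in> space (P y)" for \<omega>
      using G(1) that by (simp add: space_P)
  qed (rule U_meas)
  have dom: "integrable (P y) (\<lambda>_. 1 + v * (K * t))" "AE \<omega> in P y. (\<lambda>n. U n \<omega>) \<longlonglongrightarrow> G \<omega>"
    "\<And>n. AE \<omega> in P y. norm (U n \<omega>) \<le> 1 + v * (K * t)"
    using G(1) U_bound by (auto simp: space_P intro!: AE_I2)
  note dct = integrable_dominated_convergence[OF G_meas U_meas dom]
    integral_dominated_convergence[OF G_meas U_meas dom]
  have G_le: "(\<integral>\<omega>. G \<omega> \<partial>P y) \<le> v / V y"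
    by (rule LIMSEQ_le_const2[OF dct(2)]) (use U_le in blast)
  have stay_iff: "path_from X 0 \<omega> \<in> stay_paths V v t \<longleftrightarrow> \<not> hit \<omega>" if "\<omega> \<in> space M" for \<omega>
    using path_from_stay_paths[OF V(1) that _ t, of 0 v] by (auto simp: hit_def not_less)
  let ?stay = "{\<omega> \<in> space M. path_from X 0 \<omega> \<in> stay_paths V v t}"
  have stay_sets: "?stay \<in> sets (P y)"
    using measurable_sets[OF measurable_path_from sets_stay_paths[OF V(1) t], of 0] unfolding sets_P
    by (simp add: vimage_def Int_def conj_commute)
  have "1 - measure (P y) ?stay - v * (t * \<phi> (1 / v))
    = (\<integral>\<omega>. 1 - indicator ?stay \<omega> - v * (t * \<phi> (1 / v)) \<partial>P y)"
  proof -
    have i: "integrable (P y) (indicator ?stay :: _ \<Rightarrow> real)"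
      using stay_sets by (intro integrable_real_indicator) (simp_all add: Py.emeasure_eq_measure)
    have "?stay \<inter> space (P y) = ?stay"
      by (auto simp: space_P)
    then show ?thesis
      using i by (simp add: Py.prob_space del: Collect_conj_eq)
  qed
  also have "\<dots> \<le> (\<integral>\<omega>. G \<omega> \<partial>P y)"
  proof (rule integral_mono[OF _ dct(1)])
    show "integrable (P y) (\<lambda>\<omega>. 1 - indicator ?stay \<omega> - v * (t * \<phi> (1 / v)))"
      using stay_sets
      by (intro Bochner_Integration.integrable_diff integrable_real_indicator) (simp_all add: Py.emeasure_eq_measure)
    show "1 - indicator ?stay \<omega> - v * (t * \<phi> (1 / v)) \<le> G \<omega>" if "\<omega> \<in> space (P y)" for \<omega>
    proof -
      have \<omega>: "\<omega> \<in> space M"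
        using that by (simp add: space_P)
      have "1 - indicator ?stay \<omega> = (of_bool (hit \<omega>) :: real)"
        using \<omega> stay_iff[OF \<omega>] by simp
      then show ?thesis
        using G(2)[OF \<omega>] by simp
    qed
  qed
  also have "\<dots> \<le> v / V y"
    by (rule G_le)
  finally show ?thesis
    by simp
qed

end

section \<open>Excursions to high levels\<close>

context strong_markov_process
begin

lemma sets_path_event:
  assumes "0 \<le> s" and "A \<in> sets (P x)" and "B \<in> sets path_space"
  shows "{\<omega> \<in> A. path_from X s \<omega> \<in> B} \<in> sets (P x)"
proof -
  have "A \<inter> (path_from X s -` B \<inter> space M) \<in> sets (P x)"
    using assms(2) measurable_sets[OF measurable_path_from[OF assms(1)] assms(3)]
    unfolding sets_P by (rule sets.Int)
  moreover have "A \<inter> (path_from X s -` B \<inter> space M) = {\<omega> \<in> A. path_from X s \<omega> \<in> B}"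
    using sets.sets_into_space[OF assms(2)] by (auto simp: space_P)
  ultimately show ?thesis
    by (simp only:)
qed

text \<open>For disjoint events this is additivity. In general each path is assigned to the earliest time
  \<open>s\<close> at which \<open>E s\<close> occurs; that this is the earliest one is known at time \<open>s\<close>, so the
  Markov property still applies. Thus finite sets of times replace a stopping time.\<close>

lemma markov_finite_union_ge:
  assumes I: "finite I" "I \<subseteq> {0..}" and E: "\<And>s. s \<in> I \<Longrightarrow> E s \<in> sets (F s)" and B: "B \<in> sets path_space"
    and ge: "\<And>s \<omega>. s \<in> I \<Longrightarrow> \<omega> \<in> E s \<Longrightarrow> c \<le> measure (P (X s \<omega>)) {\<omega>' \<in> space M. path_from X 0 \<omega>' \<in> B}"
  shows "c * measure (P x) (\<Union>s\<in>I. E s) \<le> measure (P x) (\<Union>s\<in>I. {\<omega> \<in> E s. path_from X s \<omega> \<in> B})"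
proof -
  interpret Px: prob_space "P x" by (rule prob_space_P)
  define E' where "E' s = E s - (\<Union>u\<in>{u \<in> I. u < s}. E u)" for s
  have F_P: "sets (F s) \<subseteq> sets (P x)" if "s \<in> I" for s
    using subalgebra_P[of s x] that I(2) by (auto simp: subalgebra_def)
  have E'_F: "E' s \<in> sets (F s)" if "s \<in> I" for s
  proof -
    have "E u \<in> sets (F s)" if "u \<in> I" "u < s" for u
      using E[OF that(1)] mono_F[of u s] that I(2) by auto
    then show ?thesis
      unfolding E'_def using E[OF that] I(1) by (intro sets.Diff sets.finite_UN) auto
  qed
  have E_P: "E s \<in> sets (P x)" if "s \<in> I" for s
    using E[OF that] F_P[OF that] by blast
  have path_P: "{\<omega> \<in> A. path_from X s \<omega> \<in> B} \<in> sets (P x)" if "s \<in> I" "A \<in> sets (P x)" for s A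
    using that I(2) B by (intro sets_path_event) auto
  have E'_P: "E' s \<in> sets (P x)" if "s \<in> I" for s
    using E'_F[OF that] F_P[OF that] by blast
  have disj: "disjoint_family_on E' I"
    unfolding disjoint_family_on_def
  proof (intro ballI impI)
    fix s u assume "s \<in> I" "u \<in> I" "s \<noteq> u"
    then show "E' s \<inter> E' u = {}"
      by (cases "s < u") (auto simp: E'_def)
  qed
  have "(\<Union>s\<in>I. E s) \<subseteq> (\<Union>s\<in>I. E' s)"
  proof
    fix \<omega> assume "\<omega> \<in> (\<Union>s\<in>I. E s)"
    then have J: "finite {s \<in> I. \<omega> \<in> E s}" "{s \<in> I. \<omega> \<in> E s} \<noteq> {}"
      using I(1) by auto
    define s where "s = Min {s \<in> I. \<omega> \<in> E s}"
    have "s \<in> I" "\<omega> \<in> E s" "\<And>u. u \<in> I \<Longrightarrow> \<omega> \<in> E u \<Longrightarrow> s \<le> u"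
      using Min_in[OF J] Min_le[OF J(1)] by (auto simp: s_def)
    then show "\<omega> \<in> (\<Union>s\<in>I. E' s)"
      by (force simp: E'_def)
  qed
  then have union: "(\<Union>s\<in>I. E s) = (\<Union>s\<in>I. E' s)"
    by (auto simp: E'_def)
  have "c * measure (P x) (\<Union>s\<in>I. E s) = (\<Sum>s\<in>I. c * measure (P x) (E' s))"
    unfolding union using E'_P disj I(1)
    by (subst Px.finite_measure_finite_Union) (auto simp: sum_distrib_left)
  also have "\<dots> \<le> (\<Sum>s\<in>I. measure (P x) {\<omega> \<in> E' s. path_from X s \<omega> \<in> B})"
  proof (rule sum_mono)
    fix s assume s: "s \<in> I"
    show "c * measure (P x) (E' s) \<le> measure (P x) {\<omega> \<in> E' s. path_from X s \<omega> \<in> B}"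
      using s I(2) by (intro markov_ge E'_F B ge) (auto simp: E'_def)
  qed
  also have "\<dots> = measure (P x) (\<Union>s\<in>I. {\<omega> \<in> E' s. path_from X s \<omega> \<in> B})"
  proof (rule Px.finite_measure_finite_Union[OF I(1), symmetric])
    show "(\<lambda>s. {\<omega> \<in> E' s. path_from X s \<omega> \<in> B}) ` I \<subseteq> sets (P x)"
      using path_P E'_P by blast
    show "disjoint_family_on (\<lambda>s. {\<omega> \<in> E' s. path_from X s \<omega> \<in> B}) I"
      using disj by (rule disjoint_family_on_bisimulation) blast
  qed
  also have "\<dots> \<le> measure (P x) (\<Union>s\<in>I. {\<omega> \<in> E s. path_from X s \<omega> \<in> B})"
  proof (rule Px.finite_measure_mono)
    show "(\<Union>s\<in>I. {\<omega> \<in> E s. path_from X s \<omega> \<in> B}) \<in> sets (P x)"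
      using path_P E_P by (intro sets.finite_UN I(1)) blast
  qed (auto simp: E'_def)
  finally show ?thesis .
qed

lemma markov_countable_union_ge:
  assumes I: "countable I" "I \<subseteq> {0..}" and E: "\<And>s. s \<in> I \<Longrightarrow> E s \<in> sets (F s)" and B: "B \<in> sets path_space"
    and ge: "\<And>s \<omega>. s \<in> I \<Longrightarrow> \<omega> \<in> E s \<Longrightarrow> c \<le> measure (P (X s \<omega>)) {\<omega>' \<in> space M. path_from X 0 \<omega>' \<in> B}"
  defines "G \<equiv> \<Union>s\<in>I. {\<omega> \<in> E s. path_from X s \<omega> \<in> B}"
  shows "G \<in> sets (P x)" "c * measure (P x) (\<Union>s\<in>I. E s) \<le> measure (P x) G"
proof -
  interpret Px: prob_space "P x" by (rule prob_space_P)
  have E_P: "E s \<in> sets (P x)" if "s \<in> I" for s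
    using E[OF that] subalgebra_P[of s x] that I(2) by (auto simp: subalgebra_def)
  have "{\<omega> \<in> E s. path_from X s \<omega> \<in> B} \<in> sets (P x)" if "s \<in> I" for s
    using that I(2) E_P B by (intro sets_path_event) auto
  then show G: "G \<in> sets (P x)"
    unfolding G_def using I(1) by (intro sets.countable_UN') auto
  show "c * measure (P x) (\<Union>s\<in>I. E s) \<le> measure (P x) G"
  proof (cases "I = {}")
    case False
    define e where "e = from_nat_into I"
    have e: "range e = I"
      unfolding e_def using range_from_nat_into[OF False I(1)] .
    define A where "A n = (\<Union>s\<in>e ` {..n}. E s)" for n
    have "A n \<in> sets (P x)" for n
      unfolding A_def using E_P e by (intro sets.finite_UN) auto
    moreover have "incseq A"
      unfolding A_def incseq_def by (auto intro: order_trans)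
    ultimately have "(\<lambda>n. measure (P x) (A n)) \<longlonglongrightarrow> measure (P x) (\<Union>n. A n)"
      by (intro Px.finite_Lim_measure_incseq) auto
    then have "(\<lambda>n. c * measure (P x) (A n)) \<longlonglongrightarrow> c * measure (P x) (\<Union>n. A n)"
      by (intro tendsto_intros)
    moreover have "(\<Union>n. A n) = (\<Union>s\<in>I. E s)"
      unfolding A_def e[symmetric] by auto
    moreover have "c * measure (P x) (A n) \<le> measure (P x) G" for n
    proof -
      have "c * measure (P x) (A n) \<le> measure (P x) (\<Union>s\<in>e ` {..n}. {\<omega> \<in> E s. path_from X s \<omega> \<in> B})"
        unfolding A_def by (rule markov_finite_union_ge) (use e I E B ge in auto)
      also have "\<dots> \<le> measure (P x) G"
        using e by (intro Px.finite_measure_mono G) (auto simp: G_def)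
      finally show ?thesis .
    qed
    ultimately show ?thesis
      by (intro LIMSEQ_le_const2[where X="\<lambda>n. c * measure (P x) (A n)"]) auto
  qed (simp add: G_def)
qed

text \<open>The event of exceeding \<open>r\<close> before falling below \<open>l\<close>, expressed by rational coordinates.\<close>

definition rise_paths :: "('x \<Rightarrow> real) \<Rightarrow> real \<Rightarrow> real \<Rightarrow> (real \<Rightarrow> 'x) set"
  where "rise_paths V l r = {p \<in> space path_space.
    \<exists>s\<in>\<rat> \<inter> {0..}. r < V (p s) \<and> (\<forall>u\<in>\<rat> \<inter> {0..<s}. l \<le> V (p u))}"

lemma sets_rise_paths:
  fixes V :: "'x \<Rightarrow> real"
  assumes "continuous_on UNIV V"
  shows "rise_paths V l r \<in> sets path_space"
proof -
  have [measurable]: "V \<in> borel_measurable borel"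
    using assms(1) by (rule borel_measurable_continuous_onI)
  have [measurable]: "(\<lambda>p. p u) \<in> path_space \<rightarrow>\<^sub>M (borel :: 'x measure)" if "0 \<le> u" for u
    unfolding path_space_def using that by (intro measurable_component_singleton) auto
  have *: "{p \<in> space path_space. r < V (p u)} \<in> sets path_space"
    "{p \<in> space path_space. l \<le> V (p u)} \<in> sets path_space" if "0 \<le> u" for u
    using that by measurable
  have c: "countable (\<rat> \<inter> A :: real set)" for A
    using countable_rat by auto
  show ?thesis
    unfolding rise_paths_def
    by (intro sets.sets_Collect_countable_Ex' sets.sets_Collect_conj sets.sets_Collect_countable_All' c *) auto
qed

lemma rise_paths_if_above_before_below:
  fixes V :: "'x \<Rightarrow> real"
  assumes V: "continuous_on UNIV V" and \<omega>: "\<omega> \<in> space M"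
    and less: "time_above V X r \<omega> < time_below V X l \<omega>"
  shows "path_from X 0 \<omega> \<in> rise_paths V l r"
proof -
  obtain a where a: "0 \<le> a" "r < V (X a \<omega>)" "ennreal a < time_below V X l \<omega>"
    using less unfolding time_above_def by (auto simp: INF_less_iff)
  then obtain z where z: "ennreal a < z" "z < time_below V X l \<omega>"
    using dense by blast
  define e where "e = enn2real z"
  have e: "ennreal e = z"
    unfolding e_def using z(2) by (intro ennreal_enn2real) (metis less_top top.not_eq_extremum order.strict_trans2 top_greatest)
  have "a < e"
    using z(1) a(1) unfolding e[symmetric] by (simp add: ennreal_less_iff)
  have "\<forall>\<^sub>F u in at_right a. r < V (X u \<omega>)"
    using right_continuous_V[OF V \<omega>, rule_format, OF a(1)] a(2) by (rule order_tendstoD(1))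
  then obtain s where s: "s \<in> \<rat>" "a < s" "s < e" "r < V (X s \<omega>)"
    using \<open>a < e\<close> by (rule rational_right_of)
  have "l \<le> V (X u \<omega>)" if "0 \<le> u" "u < s" for u
  proof (rule ccontr)
    assume "\<not> l \<le> V (X u \<omega>)"
    then have "time_below V X l \<omega> \<le> ennreal u"
      unfolding time_below_def using that by (intro INF_lower) auto
    also have "\<dots> \<le> ennreal e"
      using that s by (intro ennreal_leI) auto
    finally show False
      using z(2) e by simp
  qed
  then show ?thesis
    unfolding rise_paths_def
    using s a(1) measurable_space[OF measurable_path_from \<omega>, of 0]
    by (auto simp: path_from_def intro!: bexI[of _ s])
qed

text \<open>The three-stage path: high at time \<open>\<delta>\<close>, then above \<open>r\<close> at some time \<open>s\<close> without having fallen
  below \<open>l\<close>, then above \<open>v\<close> throughout \<open>{s..s + t}\<close>. The Markov property is used at \<open>\<delta>\<close> for the second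
  stage and at the rational times \<open>s\<close> for the third.\<close>

lemma excursion_probability:
  fixes V :: "'x \<Rightarrow> real"
  assumes V: "continuous_on UNIV V" and \<delta>: "0 \<le> \<delta>" "\<delta> \<in> \<rat>" and t: "0 \<le> t" and q: "0 \<le> q"
    and rise: "\<And>y. k \<le> V y \<Longrightarrow> p \<le> measure (P y) {\<omega> \<in> space (P y). time_above V X r \<omega> < time_below V X l \<omega>}"
    and stay: "\<And>y. r < V y \<Longrightarrow> q \<le> measure (P y) {\<omega> \<in> space M. path_from X 0 \<omega> \<in> stay_paths V v t}"
  obtains G where "G \<in> sets (P x)"
    "q * (p * measure (P x) {\<omega> \<in> space M. k \<le> V (X \<delta> \<omega>)}) \<le> measure (P x) G"
    "\<And>\<omega>. \<omega> \<in> G \<Longrightarrow> \<omega> \<in> space M \<and> (\<exists>s\<ge>\<delta>. (\<forall>u\<in>{\<delta>..<s}. l \<le> V (X u \<omega>)) \<and> (\<forall>u\<in>{s..s + t}. v \<le> V (X u \<omega>)))"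
proof -
  interpret Px: prob_space "P x" by (rule prob_space_P)
  define I where "I = \<rat> \<inter> {\<delta>..}"
  define A where "A = {\<omega> \<in> space M. k \<le> V (X \<delta> \<omega>)}"
  define E where "E s = {\<omega> \<in> space M. r < V (X s \<omega>) \<and> (\<forall>u\<in>\<rat> \<inter> {\<delta>..<s}. l \<le> V (X u \<omega>))}" for s
  define G where "G = (\<Union>s\<in>I. {\<omega> \<in> E s. path_from X s \<omega> \<in> stay_paths V v t})"
  have c: "countable (\<rat> \<inter> S :: real set)" for S
    using countable_rat by auto
  have meas: "{\<omega> \<in> space M. c \<le> V (X u \<omega>)} \<in> sets (F s)" "{\<omega> \<in> space M. c < V (X u \<omega>)} \<in> sets (F s)"
    if "0 \<le> u" "u \<le> s" for u s c
  proof -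
    have *: "space (F s) = space M"
      using subalgebra_F[of s] that by (simp add: subalgebra_def)
    show "{\<omega> \<in> space M. c \<le> V (X u \<omega>)} \<in> sets (F s)" "{\<omega> \<in> space M. c < V (X u \<omega>)} \<in> sets (F s)"
      using measurable_V_X[OF V that] unfolding *[symmetric] by measurable
  qed
  have I: "countable I" "I \<subseteq> {0..}"
    using c \<delta> by (auto simp: I_def)
  have E: "E s \<in> sets (F s)" if "s \<in> I" for s
  proof -
    have "0 \<le> s" "\<delta> \<le> s"
      using that \<delta> by (auto simp: I_def)
    then have space: "space (F s) = space M"
      using subalgebra_F[of s] by (simp add: subalgebra_def)
    show ?thesis
      unfolding E_def space[symmetric]
      by (intro sets.sets_Collect_conj sets.sets_Collect_countable_All' c; unfold space)
         (use \<delta> \<open>\<delta> \<le> s\<close> in \<open>auto intro!: meas\<close>)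
  qed
  have stay': "q \<le> measure (P (X s \<omega>)) {\<omega>' \<in> space M. path_from X 0 \<omega>' \<in> stay_paths V v t}"
    if "s \<in> I" "\<omega> \<in> E s" for s \<omega>
    using that by (intro stay) (simp add: E_def)
  note mk = markov_countable_union_ge[where x=x and I=I and E=E and c=q, OF I E sets_stay_paths[OF V t] stay', folded G_def]
  have G: "G \<in> sets (P x)"
    by (rule mk(1))
  have G_ge: "q * measure (P x) (\<Union>s\<in>I. E s) \<le> measure (P x) G"
    by (rule mk(2))
  have A: "A \<in> sets (F \<delta>)"
    unfolding A_def using \<delta> by (intro meas) auto
  have "p * measure (P x) A \<le> measure (P x) {\<omega> \<in> A. path_from X \<delta> \<omega> \<in> rise_paths V l r}"
  proof (rule markov_ge[OF \<delta>(1) A sets_rise_paths[OF V]])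
    fix \<omega> assume "\<omega> \<in> A"
    interpret Py: prob_space "P (X \<delta> \<omega>)" by (rule prob_space_P)
    have "p \<le> measure (P (X \<delta> \<omega>)) {\<omega>' \<in> space (P (X \<delta> \<omega>)). time_above V X r \<omega>' < time_below V X l \<omega>'}"
      using \<open>\<omega> \<in> A\<close> by (intro rise) (simp add: A_def)
    also have "\<dots> \<le> measure (P (X \<delta> \<omega>)) {\<omega>' \<in> space M. path_from X 0 \<omega>' \<in> rise_paths V l r}"
    proof (rule Py.finite_measure_mono)
      show "{\<omega>' \<in> space (P (X \<delta> \<omega>)). time_above V X r \<omega>' < time_below V X l \<omega>'}
          \<subseteq> {\<omega>' \<in> space M. path_from X 0 \<omega>' \<in> rise_paths V l r}"
        using rise_paths_if_above_before_below[OF V] by (auto simp: space_P)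
      show "{\<omega>' \<in> space M. path_from X 0 \<omega>' \<in> rise_paths V l r} \<in> sets (P (X \<delta> \<omega>))"
        using measurable_sets[OF measurable_path_from sets_rise_paths[OF V], of 0] unfolding sets_P
        by (simp add: vimage_def Int_def conj_commute)
    qed
    finally show "p \<le> measure (P (X \<delta> \<omega>)) {\<omega>' \<in> space M. path_from X 0 \<omega>' \<in> rise_paths V l r}" .
  qed
  also have "\<dots> \<le> measure (P x) (\<Union>s\<in>I. E s)"
  proof (rule Px.finite_measure_mono)
    show "(\<Union>s\<in>I. E s) \<in> sets (P x)"
    proof (rule sets.countable_UN'[OF I(1)])
      have "E s \<in> sets (P x)" if "s \<in> I" for s
        using E[OF that] subalgebra_P[of s x] that I(2) by (auto simp: subalgebra_def)
      then show "E ` I \<subseteq> sets (P x)"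
        by blast
    qed
    show "{\<omega> \<in> A. path_from X \<delta> \<omega> \<in> rise_paths V l r} \<subseteq> (\<Union>s\<in>I. E s)"
    proof
      fix \<omega> assume "\<omega> \<in> {\<omega> \<in> A. path_from X \<delta> \<omega> \<in> rise_paths V l r}"
      then obtain s where \<omega>: "\<omega> \<in> space M" and s: "s \<in> \<rat>" "0 \<le> s" "r < V (X (\<delta> + s) \<omega>)"
        and above: "\<And>u. u \<in> \<rat> \<Longrightarrow> 0 \<le> u \<Longrightarrow> u < s \<Longrightarrow> l \<le> V (X (\<delta> + u) \<omega>)"
        unfolding rise_paths_def A_def path_from_def by force
      have "l \<le> V (X u \<omega>)" if "u \<in> \<rat>" "\<delta> \<le> u" "u < \<delta> + s" for u
        using above[of "u - \<delta>"] that \<delta> by auto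
      then have "\<omega> \<in> E (\<delta> + s)"
        using \<omega> s by (auto simp: E_def)
      moreover have "\<delta> + s \<in> I"
        using s \<delta> by (auto simp: I_def)
      ultimately show "\<omega> \<in> (\<Union>s\<in>I. E s)"
        by blast
    qed
  qed
  finally have "q * (p * measure (P x) A) \<le> q * measure (P x) (\<Union>s\<in>I. E s)"
    using q by (rule mult_left_mono)
  also have "\<dots> \<le> measure (P x) G"
    by (rule G_ge)
  finally have large: "q * (p * measure (P x) {\<omega> \<in> space M. k \<le> V (X \<delta> \<omega>)}) \<le> measure (P x) G"
    unfolding A_def .
  have "\<omega> \<in> space M \<and> (\<exists>s\<ge>\<delta>. (\<forall>u\<in>{\<delta>..<s}. l \<le> V (X u \<omega>)) \<and> (\<forall>u\<in>{s..s + t}. v \<le> V (X u \<omega>)))"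
    if "\<omega> \<in> G" for \<omega>
  proof -
    from that obtain s where s: "s \<in> \<rat>" "\<delta> \<le> s" and \<omega>: "\<omega> \<in> space M"
      and above: "\<And>u. u \<in> \<rat> \<Longrightarrow> \<delta> \<le> u \<Longrightarrow> u < s \<Longrightarrow> l \<le> V (X u \<omega>)"
      and "path_from X s \<omega> \<in> stay_paths V v t"
      unfolding G_def E_def I_def by auto
    then have "\<forall>u\<in>{s..s + t}. v \<le> V (X u \<omega>)"
      using path_from_stay_paths[OF V \<omega> _ t, of s v] \<delta> by simp
    moreover have "l \<le> V (X u \<omega>)" if "u \<in> {\<delta>..<s}" for u
    proof (rule right_continuous_ge[where f="\<lambda>u. V (X u \<omega>)" and e=s])
      show "((\<lambda>u. V (X u \<omega>)) \<longlongrightarrow> V (X u \<omega>)) (at_right u)"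
        using right_continuous_V[OF V \<omega>] that \<delta> by auto
    qed (use that above in auto)
    ultimately show "\<omega> \<in> space M \<and> (\<exists>s\<ge>\<delta>. (\<forall>u\<in>{\<delta>..<s}. l \<le> V (X u \<omega>)) \<and> (\<forall>u\<in>{s..s + t}. v \<le> V (X u \<omega>)))"
      using s(2) \<omega> by blast
  qed
  note paths = this
  show thesis
  proof (rule that)
    show "\<omega> \<in> space M \<and> (\<exists>s\<ge>\<delta>. (\<forall>u\<in>{\<delta>..<s}. l \<le> V (X u \<omega>)) \<and> (\<forall>u\<in>{s..s + t}. v \<le> V (X u \<omega>)))"
      if "\<omega> \<in> G" for \<omega>
      using that by (rule paths)
  qed (rule G, rule large)
qed

text \<open>Otherwise \<open>V(X)\<close> would almost surely be bounded by \<open>k\<close> at all positive rational times, hence at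
  all times.\<close>

lemma reaches_high_level:
  fixes V :: "'x \<Rightarrow> real"
  assumes V: "continuous_on UNIV V"
    and unbounded: "AE \<omega> in P x. Limsup at_top (\<lambda>t. ereal (V (X t \<omega>))) = \<infinity>"
  obtains \<delta> where "0 < \<delta>" "\<delta> \<in> \<rat>" "0 < measure (P x) {\<omega> \<in> space M. k \<le> V (X \<delta> \<omega>)}"
proof -
  interpret Px: prob_space "P x" by (rule prob_space_P)
  have "\<exists>u\<in>\<rat> \<inter> {0<..}. measure (P x) {\<omega> \<in> space M. k \<le> V (X u \<omega>)} \<noteq> 0"
  proof (rule ccontr)
    assume "\<not> ?thesis"
    then have zero: "measure (P x) {\<omega> \<in> space M. k \<le> V (X u \<omega>)} = 0" if "u \<in> \<rat>" "0 < u" for u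
      using that by simp
    have "AE \<omega> in P x. V (X u \<omega>) < k" if "u \<in> \<rat> \<inter> {0<..}" for u
    proof -
      have "(\<lambda>\<omega>. V (X u \<omega>)) \<in> borel_measurable M"
        using that by (intro measurable_V_X'[OF V]) simp
      then have "{\<omega> \<in> space M. k \<le> V (X u \<omega>)} \<in> sets (P x)"
        unfolding sets_P by measurable
      then have "{\<omega> \<in> space M. k \<le> V (X u \<omega>)} \<in> null_sets (P x)"
        using zero[of u] that by (simp add: null_sets_def Px.emeasure_eq_measure)
      then show ?thesis
        by (rule AE_I') (auto simp: space_P not_less)
    qed
    moreover have "countable (\<rat> \<inter> {0<..} :: real set)"
      using countable_rat by auto
    ultimately have "AE \<omega> in P x. \<forall>u\<in>\<rat> \<inter> {0<..}. V (X u \<omega>) < k"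
      by (simp add: AE_ball_countable)
    then have "AE \<omega> in P x. False"
      using unbounded AE_space
    proof eventually_elim
      case (elim \<omega>)
      have "V (X u \<omega>) \<le> k" if "0 \<le> u" for u
      proof (rule right_continuous_le[where f="\<lambda>u. V (X u \<omega>)" and e="u + 1"])
        show "((\<lambda>u. V (X u \<omega>)) \<longlongrightarrow> V (X u \<omega>)) (at_right u)"
          using right_continuous_V[OF V] elim(3) that by (auto simp: space_P)
      qed (use that elim(1) in \<open>auto intro: less_imp_le\<close>)
      then have "\<forall>\<^sub>F t in at_top. ereal (V (X t \<omega>)) \<le> ereal k"
        by (intro eventually_at_top_linorderI[of 0]) auto
      then have "Limsup at_top (\<lambda>t. ereal (V (X t \<omega>))) \<le> ereal k"
        by (rule Limsup_bounded)
      then show False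
        using elim(2) by simp
    qed
    then show False
      by simp
  qed
  then obtain u where "u \<in> \<rat>" "0 < u" "measure (P x) {\<omega> \<in> space M. k \<le> V (X u \<omega>)} \<noteq> 0"
    by auto
  then show thesis
    by (intro that[of u]) (simp_all add: zero_less_measure_iff)
qed

end

section \<open>Consequences for return times\<close>

lemma return_time_ge:
  assumes "\<And>u. \<delta> < u \<Longrightarrow> u \<le> a \<Longrightarrow> X u \<omega> \<notin> D"
  shows "ennreal a \<le> return_time X D \<delta> \<omega>"
  unfolding return_time_def
proof (rule INF_greatest)
  show "ennreal a \<le> ennreal u" if "u \<in> {t. \<delta> < t \<and> X t \<omega> \<in> D}" for u
    using assms[of u] that by (intro ennreal_leI) (cases "u \<le> a", auto)
qed

lemma nn_integral_ge_of_lower_bound: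
  fixes g :: "real \<Rightarrow> ennreal"
  assumes "{a..a + t} \<subseteq> A" and "\<And>u. u \<in> {a..a + t} \<Longrightarrow> ennreal c \<le> g u" and "0 \<le> t" and "0 \<le> c"
  shows "ennreal (c * t) \<le> (\<integral>\<^sup>+u\<in>A. g u \<partial>lborel)"
proof -
  have "ennreal (c * t) = (\<integral>\<^sup>+u. ennreal c * indicator {a..a + t} u \<partial>lborel)"
    using assms(3,4) by (simp add: nn_integral_cmult_indicator ennreal_mult)
  also have "\<dots> \<le> (\<integral>\<^sup>+u\<in>A. g u \<partial>lborel)"
    using assms(1,2) by (intro nn_integral_mono) (auto simp: indicator_def)
  finally show ?thesis .
qed

lemma event_prob_ge:
  assumes "prob_space Q" and "A \<in> sets Q" and "A \<subseteq> E" and "c \<le> measure Q A"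
  shows "c \<le> event_prob Q E"
proof -
  interpret Q: prob_space Q by fact
  have "measure Q A \<le> event_prob Q E"
    unfolding event_prob_def
  proof (rule cSUP_upper)
    show "bdd_above (measure Q ` {A \<in> sets Q. A \<subseteq> E})"
      by (rule bdd_aboveI[of _ 1]) auto
  qed (use assms in auto)
  with assms(4) show ?thesis
    by simp
qed

section \<open>The level function\<close>

text \<open>A strictly decreasing function with nonnegative values is positive.\<close>

lemma rate_pos:
  fixes \<phi> :: "real \<Rightarrow> real"
  assumes "\<forall>s\<in>{0<..1}. 0 \<le> \<phi> s" and "strict_antimono_on {1..} (\<lambda>r. r * \<phi> (1 / r))" and "1 \<le> v"
  shows "0 < v * \<phi> (1 / v)"
proof -
  have "(v + 1) * \<phi> (1 / (v + 1)) < v * \<phi> (1 / v)"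
    using monotone_onD[OF assms(2), of v "v + 1"] assms(3) by simp
  moreover have "0 \<le> (v + 1) * \<phi> (1 / (v + 1))"
    using assms(1,3) by simp
  ultimately show ?thesis
    by linarith
qed

text \<open>The function \<open>f v = \<epsilon> h v / (v \<phi> (1 / v))\<close> is continuous, non-decreasing and tends to infinity,
  since its numerator is at least \<open>\<epsilon>\<close> and its denominator tends to \<open>0\<close>. So it takes every value beyond
  \<open>f L\<close>, and only to the right of \<open>L\<close>; on such values \<open>G_inv\<close> is a genuine inverse.\<close>

lemma G_inv_properties:
  fixes \<phi> h :: "real \<Rightarrow> real"
  assumes \<phi>: "\<forall>s\<in>{0<..1}. 0 \<le> \<phi> s" "continuous_on {0<..1} \<phi>"
    "strict_antimono_on {1..} (\<lambda>r. r * \<phi> (1 / r))" "((\<lambda>r. r * \<phi> (1 / r)) \<longlongrightarrow> 0) at_top"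
    and h: "\<forall>v\<ge>1. 1 \<le> h v" "mono_on {1..} h" "continuous_on {1..} h"
    and \<epsilon>: "0 < \<epsilon>" and L: "1 \<le> L" and r: "\<epsilon> * h L / (L * \<phi> (1 / L)) < r"
  shows "L < G_inv \<epsilon> \<phi> h r"
    and "\<epsilon> * h (G_inv \<epsilon> \<phi> h r) / (G_inv \<epsilon> \<phi> h r * \<phi> (1 / G_inv \<epsilon> \<phi> h r)) = r"
proof -
  define g where "g v = v * \<phi> (1 / v)" for v
  define f where "f v = \<epsilon> * h v / g v" for v
  have g: "0 < g v" if "1 \<le> v" for v
    unfolding g_def using rate_pos[OF \<phi>(1,3) that] .
  have f_mono: "f a \<le> f b" if "1 \<le> a" "a \<le> b" for a b
  proof -
    have "g b \<le> g a"
      using monotone_onD[OF \<phi>(3), of a b] that by (cases "a = b") (auto simp: g_def)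
    moreover have "h a \<le> h b" "1 \<le> h b"
      using mono_onD[OF h(2), of a b] h(1) that by auto
    moreover have "0 < g b"
      using that by (intro g) simp
    ultimately have "(\<epsilon> * h a) / g a \<le> (\<epsilon> * h b) / g b"
      using \<epsilon> by (intro frac_le mult_left_mono) simp_all
    then show ?thesis
      by (simp add: f_def)
  qed
  have "1 \<le> h L"
    using h(1) L by simp
  then have "0 < f L"
    unfolding f_def using \<epsilon> g[OF L] by simp
  then have r0: "0 < r"
    using r by (simp add: f_def g_def)
  have "\<forall>\<^sub>F v in at_top. g v < \<epsilon> / r"
    unfolding g_def using \<phi>(4) by (rule order_tendstoD(2)) (use \<epsilon> r0 in simp)
  then obtain b where b: "L \<le> b" "g b < \<epsilon> / r"
    using eventually_happens[OF eventually_conj[OF eventually_ge_at_top[of L]]] by (metis trivial_limit_at_top_linorder)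
  have b1: "1 \<le> b"
    using b L by simp
  have "r \<le> f b"
  proof -
    have "r * g b \<le> \<epsilon> * 1"
      using b(2) r0 by (simp add: field_simps)
    also have "\<dots> \<le> \<epsilon> * h b"
      using \<epsilon> h(1) b1 by (intro mult_left_mono) auto
    finally show ?thesis
      unfolding f_def using g[OF b1] by (simp add: field_simps)
  qed
  moreover have "f L \<le> r"
    using r by (simp add: f_def g_def)
  moreover have "continuous_on {L..b} f"
  proof -
    have "continuous_on {L..b} (\<lambda>v. \<phi> (1 / v))"
      by (rule continuous_on_compose2[OF \<phi>(2)]) (use L in \<open>auto intro!: continuous_intros\<close>)
    moreover have "continuous_on {L..b} h"
      using h(3) by (rule continuous_on_subset) (use L in auto)
    moreover have "g v \<noteq> 0" if "v \<in> {L..b}" for v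
      using g[of v] that L by auto
    ultimately show ?thesis
      unfolding f_def g_def by (intro continuous_intros) auto
  qed
  ultimately obtain v where "L \<le> v" "f v = r"
    using IVT'[of f L r b] b(1) by blast
  then have image: "r \<in> f ` {1..}"
    using L by auto
  define w where "w = inv_into {1..} f r"
  have w: "1 \<le> w" "f w = r"
    using inv_into_into[OF image] f_inv_into_f[OF image] by (auto simp: w_def)
  have G: "G_inv \<epsilon> \<phi> h r = w"
    unfolding G_inv_def w_def f_def g_def ..
  show "\<epsilon> * h (G_inv \<epsilon> \<phi> h r) / (G_inv \<epsilon> \<phi> h r * \<phi> (1 / G_inv \<epsilon> \<phi> h r)) = r"
    unfolding G using w(2) by (simp add: f_def g_def)
  show "L < G_inv \<epsilon> \<phi> h r"
    unfolding G
  proof (rule ccontr)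
    assume "\<not> L < w"
    then have "f w \<le> f L"
      using w(1) by (intro f_mono) auto
    then show False
      using r w(2) by (simp add: f_def g_def)
  qed
qed

section \<open>The lower bound\<close>

text \<open>Both parts of the theorem at once: on the same event the return time is at least
  \<open>t = r / h v\<close> and the additive functional is at least \<open>h v * t = r\<close>, where \<open>v\<close> is the value of
  \<open>G_inv\<close> at \<open>r\<close>. For \<open>h = 1\<close> the first bound is part (b).\<close>

lemma long_excursion_lower_bound:
  fixes M :: "'w measure"
    and F :: "real \<Rightarrow> 'w measure"
    and P :: "'x::{metric_space, second_countable_topology} \<Rightarrow> 'w measure"
    and X :: "real \<Rightarrow> 'w \<Rightarrow> 'x"
    and V :: "'x \<Rightarrow> real"
    and \<phi> \<Psi> h :: "real \<Rightarrow> real"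
  assumes "strong_markov_process M F P X" and L: "condition_L F P X V \<phi> \<Psi>"
    and D: "D \<subseteq> {x. V x \<le> m}" and q: "0 < q" "q < 1" and \<epsilon>: "\<epsilon> = (1 - q) / 2"
    and h: "\<forall>v\<ge>1. 1 \<le> h v" "mono_on {1..} h" "continuous_on {1..} h"
  shows "\<exists>C>0. \<exists>r0>0. \<exists>\<delta>>0. \<forall>r>r0. \<exists>G\<in>sets (P x).
    C / \<Psi> (2 * G_inv \<epsilon> \<phi> h r / (1 - q)) \<le> measure (P x) G \<and> G \<subseteq> space M \<and>
    (\<forall>\<omega>\<in>G. ennreal (r / h (G_inv \<epsilon> \<phi> h r)) \<le> return_time X D \<delta> \<omega> \<and>
      ennreal r \<le> (\<integral>\<^sup>+s\<in>{s. 0 \<le> s \<and> ennreal s \<le> return_time X D \<delta> \<omega>}. ennreal (h (V (X s \<omega>))) \<partial>lborel))"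
proof -
  interpret strong_markov_process M F P X by fact
  have V: "1 \<le> V y" "continuous_on UNIV V"
    and unbounded: "AE \<omega> in P y. Limsup at_top (\<lambda>t. ereal (V (X t \<omega>))) = \<infinity>" for y
    using L by (simp_all add: condition_L_def)
  obtain l0 where l0: "1 \<le> l0"
    and \<phi>: "\<forall>s\<in>{0<..1}. 0 \<le> \<phi> s" "mono_on {0<..1} \<phi>" "continuous_on {0<..1} \<phi>"
      "strict_antimono_on {1..} (\<lambda>r. r * \<phi> (1 / r))" "((\<lambda>r. r * \<phi> (1 / r)) \<longlongrightarrow> 0) at_top"
    and super: "\<exists>b\<ge>0. \<forall>x. supermartingale (P x) F
        (\<lambda>t \<omega>. 1 / V (X t \<omega>)
           - (LBINT u:{0..t}. \<phi> (1 / V (X u \<omega>)))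
           - b * (LBINT u:{0..t}. indicator {u. V (X u \<omega>) \<le> l0} u))"
    and \<Psi>: "\<forall>r\<ge>1. 1 \<le> \<Psi> r"
    and rise: "\<forall>l>l0. \<exists>C>0. \<forall>r>l + 1. \<forall>x. l + 1 \<le> V x \<longrightarrow>
        measure (P x) {\<omega> \<in> space (P x). time_above V X r \<omega> < time_below V X l \<omega>} \<ge> C / \<Psi> r"
    using L unfolding condition_L_def by blast
  obtain b where b: "0 \<le> b" and super: "\<And>y. supermartingale (P y) F
      (\<lambda>t \<omega>. 1 / V (X t \<omega>) - drift \<phi> b l0 (\<lambda>u. V (X u \<omega>)) t)"
    using super by (auto simp: drift_def diff_diff_add)
  \<comment> \<open>\<open>l > l0\<close> for condition L, and \<open>l > m\<close> so that \<open>D\<close> cannot be visited above level \<open>l\<close>.\<close>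
  define l where "l = max l0 m + 1"
  have l: "l0 < l" "m < l" "1 \<le> l"
    using l0 by (auto simp: l_def)
  obtain C where C: "0 < C" and rise: "\<And>r y. l + 1 < r \<Longrightarrow> l + 1 \<le> V y \<Longrightarrow>
      C / \<Psi> r \<le> measure (P y) {\<omega> \<in> space (P y). time_above V X r \<omega> < time_below V X l \<omega>}"
    using rise l(1) by blast
  obtain \<delta> where \<delta>: "0 < \<delta>" "\<delta> \<in> \<rat>" and start_high: "0 < measure (P x) {\<omega> \<in> space M. l + 1 \<le> V (X \<delta> \<omega>)}"
    using reaches_high_level[OF V(2) unbounded] by blast
  define p where "p = measure (P x) {\<omega> \<in> space M. l + 1 \<le> V (X \<delta> \<omega>)}"
  \<comment> \<open>\<open>r > r0\<close> puts the level \<open>v\<close> above \<open>l + 1\<close>.\<close>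
  define r0 where "r0 = \<epsilon> * h (l + 1) / ((l + 1) * \<phi> (1 / (l + 1)))"
  have \<epsilon>0: "0 < \<epsilon>"
    using q \<epsilon> by simp
  have "0 < (l + 1) * \<phi> (1 / (l + 1))" "1 \<le> h (l + 1)"
    using l by (auto intro!: rate_pos[OF \<phi>(1,4)] simp: h(1))
  then have r0: "0 < r0"
    unfolding r0_def using \<epsilon>0 by simp
  have "\<exists>G\<in>sets (P x).
    q * C * p / \<Psi> (2 * G_inv \<epsilon> \<phi> h r / (1 - q)) \<le> measure (P x) G \<and> G \<subseteq> space M \<and>
    (\<forall>\<omega>\<in>G. ennreal (r / h (G_inv \<epsilon> \<phi> h r)) \<le> return_time X D \<delta> \<omega> \<and>
      ennreal r \<le> (\<integral>\<^sup>+s\<in>{s. 0 \<le> s \<and> ennreal s \<le> return_time X D \<delta> \<omega>}. ennreal (h (V (X s \<omega>))) \<partial>lborel))"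
    if r: "r0 < r" for r
  proof -
    define v where "v = G_inv \<epsilon> \<phi> h r"
    have v: "l + 1 < v" and v_r: "\<epsilon> * h v / (v * \<phi> (1 / v)) = r"
      using G_inv_properties[OF \<phi>(1,3,4,5) h \<epsilon>0, of "l + 1" r] r l by (auto simp: v_def r0_def)
    have v1: "1 \<le> v"
      using v l by simp
    define t where "t = \<epsilon> / (v * \<phi> (1 / v))"
    define R where "R = 2 * v / (1 - q)"
    have rate: "0 < v * \<phi> (1 / v)"
      by (rule rate_pos[OF \<phi>(1,4) v1])
    have t: "0 < t"
      unfolding t_def using \<epsilon>0 rate by (rule divide_pos_pos)
    have h_v: "1 \<le> h v"
      using h(1) v1 by simp
    have r_t: "r = h v * t"
      using v_r by (simp add: t_def mult.commute)
    have "v * 1 \<le> v * (2 / (1 - q))"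
      using q v1 by (intro mult_left_mono) (simp_all add: field_simps)
    then have R: "v \<le> R"
      by (simp add: R_def mult.commute)
    then have \<Psi>_R: "1 \<le> \<Psi> R"
      using \<Psi> v1 by simp
    \<comment> \<open>The factor \<open>2 / (1 - q)\<close> between \<open>R\<close> and \<open>v\<close> and the choice of \<open>t\<close> let the starting value and the
    drift contribute \<open>\<epsilon>\<close> each to the probability of failure.\<close>
    have stay: "q \<le> measure (P y) {\<omega> \<in> space M. path_from X 0 \<omega> \<in> stay_paths V v t}" if y: "R < V y" for y
    proof -
      have "v / V y \<le> v / R"
        using y R v1 by (intro divide_left_mono) auto
      also have "v / R = \<epsilon>"
        using v1 q by (simp add: R_def \<epsilon>)
      finally have "v / V y \<le> \<epsilon>" .
      moreover have "v * (t * \<phi> (1 / v)) = \<epsilon>"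
        using rate by (auto simp: t_def)
      moreover have "1 - (v / V y + v * (t * \<phi> (1 / v)))
          \<le> measure (P y) {\<omega> \<in> space M. path_from X 0 \<omega> \<in> stay_paths V v t}"
        using v1 v l t by (intro stay_probability[OF V(2,1) \<phi>(1-3) b super]) auto
      moreover have "1 - (\<epsilon> + \<epsilon>) = q"
        by (simp add: \<epsilon>)
      ultimately show ?thesis
        by linarith
    qed
    obtain G where G: "G \<in> sets (P x)" "q * (C / \<Psi> R * p) \<le> measure (P x) G"
      and paths: "\<And>\<omega>. \<omega> \<in> G \<Longrightarrow> \<omega> \<in> space M \<and> (\<exists>s\<ge>\<delta>. (\<forall>u\<in>{\<delta>..<s}. l \<le> V (X u \<omega>)) \<and> (\<forall>u\<in>{s..s + t}. v \<le> V (X u \<omega>)))"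
      unfolding p_def
    proof (rule excursion_probability[OF V(2), of \<delta> t q "l + 1" "C / \<Psi> R" R l v x])
      show "C / \<Psi> R \<le> measure (P y) {\<omega> \<in> space (P y). time_above V X R \<omega> < time_below V X l \<omega>}" if "l + 1 \<le> V y" for y
        using that v R by (intro rise) auto
    qed (use \<delta> t q stay in auto)
    have returns: "ennreal (r / h v) \<le> return_time X D \<delta> \<omega> \<and>
      ennreal r \<le> (\<integral>\<^sup>+s\<in>{s. 0 \<le> s \<and> ennreal s \<le> return_time X D \<delta> \<omega>}. ennreal (h (V (X s \<omega>))) \<partial>lborel)"
      if "\<omega> \<in> G" for \<omega>
    proof -
      obtain s where s: "\<delta> \<le> s" "\<And>u. u \<in> {\<delta>..<s} \<Longrightarrow> l \<le> V (X u \<omega>)" "\<And>u. u \<in> {s..s + t} \<Longrightarrow> v \<le> V (X u \<omega>)"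
        using paths[OF \<open>\<omega> \<in> G\<close>] by blast
      have return: "ennreal (s + t) \<le> return_time X D \<delta> \<omega>"
      proof (rule return_time_ge)
        fix u assume "\<delta> < u" "u \<le> s + t"
        then have "l \<le> V (X u \<omega>)"
          using s(2)[of u] s(3)[of u] v by (cases "u < s") auto
        then show "X u \<omega> \<notin> D"
          using D l(2) by auto
      qed
      have "ennreal (r / h v) \<le> ennreal (s + t)"
        using r_t h_v s(1) \<delta> by (intro ennreal_leI) simp
      then have "ennreal (r / h v) \<le> return_time X D \<delta> \<omega>"
        using return by (rule order_trans)
      moreover have "ennreal r \<le> (\<integral>\<^sup>+s\<in>{s. 0 \<le> s \<and> ennreal s \<le> return_time X D \<delta> \<omega>}. ennreal (h (V (X s \<omega>))) \<partial>lborel)"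
        unfolding r_t
      proof (rule nn_integral_ge_of_lower_bound)
        show "{s..s + t} \<subseteq> {s. 0 \<le> s \<and> ennreal s \<le> return_time X D \<delta> \<omega>}"
          using s(1) \<delta> by (auto intro: order_trans[OF ennreal_leI return])
        show "ennreal (h v) \<le> ennreal (h (V (X u \<omega>)))" if "u \<in> {s..s + t}" for u
          using s(3)[OF that] v1 by (intro ennreal_leI mono_onD[OF h(2)]) auto
      qed (use t h_v in auto)
      ultimately show ?thesis
        by blast
    qed
    have "q * C * p / \<Psi> R \<le> measure (P x) G"
      using G(2) by (simp add: mult.assoc)
    moreover have "G \<subseteq> space M"
      using paths by blast
    ultimately show ?thesis
      unfolding v_def[symmetric] R_def[symmetric] using returns
      by (intro bexI[OF _ G(1)] conjI ballI) simp_all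
  qed
  then have bound: "\<exists>\<delta>>0. \<forall>r>r0. \<exists>G\<in>sets (P x).
    q * C * p / \<Psi> (2 * G_inv \<epsilon> \<phi> h r / (1 - q)) \<le> measure (P x) G \<and> G \<subseteq> space M \<and>
    (\<forall>\<omega>\<in>G. ennreal (r / h (G_inv \<epsilon> \<phi> h r)) \<le> return_time X D \<delta> \<omega> \<and>
      ennreal r \<le> (\<integral>\<^sup>+s\<in>{s. 0 \<le> s \<and> ennreal s \<le> return_time X D \<delta> \<omega>}. ennreal (h (V (X s \<omega>))) \<partial>lborel))"
    using \<delta>(1) by (intro exI[of _ \<delta>] conjI allI impI)
  have pos: "0 < q * C * p"
    using q C start_high by (simp add: p_def)
  show ?thesis
    by (rule exI[of _ "q * C * p"], rule conjI[OF pos], rule exI[of _ r0], rule conjI[OF r0 bound])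
qed

theorem theorem2p5:
  fixes M :: "'w measure"
    and F :: "real \<Rightarrow> 'w measure"
    and P :: "'x::{metric_space, second_countable_topology} \<Rightarrow> 'w measure"
    and X :: "real \<Rightarrow> 'w \<Rightarrow> 'x"
    and \<pi> :: "'x measure"
    and V :: "'x \<Rightarrow> real"
    and \<phi> \<Psi> :: "real \<Rightarrow> real"
    and D :: "'x set"
    and m q \<epsilon> :: real
  assumes "ergodic_harris_process M F P X \<pi>"
    and "condition_L F P X V \<phi> \<Psi>"
    and "D \<in> sets borel" and "1 < m" and "D \<subseteq> {x. V x \<le> m}"
    and "0 < q" and "q < 1" and "\<epsilon> = (1 - q) / 2"
  shows "(\<forall>h :: real \<Rightarrow> real.
            (\<forall>v\<ge>1. 1 \<le> h v) \<longrightarrow> mono_on {1..} h \<longrightarrow> continuous_on {1..} h \<longrightarrow>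
            (\<forall>x. \<exists>C>0. \<exists>r0>0. \<exists>\<delta>>0. \<forall>r>r0.
               event_prob (P x) {\<omega> \<in> space M.
                 (\<integral>\<^sup>+s\<in>{s. 0 \<le> s \<and> ennreal s \<le> return_time X D \<delta> \<omega>}. ennreal (h (V (X s \<omega>))) \<partial>lborel)
                   \<ge> ennreal r}
               \<ge> C / \<Psi> (2 * G_inv \<epsilon> \<phi> h r / (1 - q))))
       \<and> (\<forall>x. \<exists>C>0. \<exists>\<delta>>0. \<exists>t0>0. \<forall>t>t0.
            event_prob (P x) {\<omega> \<in> space M. return_time X D \<delta> \<omega> \<ge> ennreal t}
            \<ge> C / \<Psi> (2 * G_inv \<epsilon> \<phi> (\<lambda>_. 1) t / (1 - q)))"
proof -
  interpret ergodic_harris_process M F P X \<pi> by fact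
  note bound = long_excursion_lower_bound[OF strong_markov_process_axioms assms(2,5-8)]
  show ?thesis
  proof (intro conjI allI impI)
    fix h :: "real \<Rightarrow> real" and x
    assume h: "\<forall>v\<ge>1. 1 \<le> h v" "mono_on {1..} h" "continuous_on {1..} h"
    obtain C r0 \<delta> where C: "0 < C" "0 < r0" "0 < \<delta>" and G: "\<forall>r>r0. \<exists>G\<in>sets (P x).
      C / \<Psi> (2 * G_inv \<epsilon> \<phi> h r / (1 - q)) \<le> measure (P x) G \<and> G \<subseteq> space M \<and>
      (\<forall>\<omega>\<in>G. ennreal (r / h (G_inv \<epsilon> \<phi> h r)) \<le> return_time X D \<delta> \<omega> \<and>
        ennreal r \<le> (\<integral>\<^sup>+s\<in>{s. 0 \<le> s \<and> ennreal s \<le> return_time X D \<delta> \<omega>}. ennreal (h (V (X s \<omega>))) \<partial>lborel))"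
      using bound[OF h, of x] by (elim exE conjE) (rule that)
    have ge: "C / \<Psi> (2 * G_inv \<epsilon> \<phi> h r / (1 - q)) \<le> event_prob (P x) {\<omega> \<in> space M.
        ennreal r \<le> (\<integral>\<^sup>+s\<in>{s. 0 \<le> s \<and> ennreal s \<le> return_time X D \<delta> \<omega>}. ennreal (h (V (X s \<omega>))) \<partial>lborel)}"
      if "r0 < r" for r
      using G[rule_format, OF that]
    proof (elim bexE conjE)
      fix A assume A: "A \<in> sets (P x)" "C / \<Psi> (2 * G_inv \<epsilon> \<phi> h r / (1 - q)) \<le> measure (P x) A" "A \<subseteq> space M"
        and returns: "\<forall>\<omega>\<in>A. ennreal (r / h (G_inv \<epsilon> \<phi> h r)) \<le> return_time X D \<delta> \<omega> \<and>
          ennreal r \<le> (\<integral>\<^sup>+s\<in>{s. 0 \<le> s \<and> ennreal s \<le> return_time X D \<delta> \<omega>}. ennreal (h (V (X s \<omega>))) \<partial>lborel)"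
      show ?thesis
      proof (rule event_prob_ge[OF prob_space_P A(1) _ A(2)], rule subsetI)
        fix \<omega> assume "\<omega> \<in> A"
        show "\<omega> \<in> {\<omega> \<in> space M.
            ennreal r \<le> (\<integral>\<^sup>+s\<in>{s. 0 \<le> s \<and> ennreal s \<le> return_time X D \<delta> \<omega>}. ennreal (h (V (X s \<omega>))) \<partial>lborel)}"
          using bspec[OF returns \<open>\<omega> \<in> A\<close>, THEN conjunct2] subsetD[OF A(3) \<open>\<omega> \<in> A\<close>]
          by (intro CollectI conjI)
      qed
    qed
    show "\<exists>C>0. \<exists>r0>0. \<exists>\<delta>>0. \<forall>r>r0.
      C / \<Psi> (2 * G_inv \<epsilon> \<phi> h r / (1 - q)) \<le> event_prob (P x) {\<omega> \<in> space M.
        ennreal r \<le> (\<integral>\<^sup>+s\<in>{s. 0 \<le> s \<and> ennreal s \<le> return_time X D \<delta> \<omega>}. ennreal (h (V (X s \<omega>))) \<partial>lborel)}"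
      by (rule exI[of _ C], rule conjI[OF C(1)], rule exI[of _ r0], rule conjI[OF C(2)],
          rule exI[of _ \<delta>], rule conjI[OF C(3)], intro allI impI, rule ge)
  next
    fix x
    have one: "\<forall>v\<ge>1::real. 1 \<le> (1 :: real)" "mono_on {1::real..} (\<lambda>_. 1 :: real)" "continuous_on {1::real..} (\<lambda>_. 1 :: real)"
      by (auto simp: mono_on_def)
    obtain C r0 \<delta> where C: "0 < C" "0 < r0" "0 < \<delta>" and G: "\<forall>r>r0. \<exists>G\<in>sets (P x).
      C / \<Psi> (2 * G_inv \<epsilon> \<phi> (\<lambda>_. 1) r / (1 - q)) \<le> measure (P x) G \<and> G \<subseteq> space M \<and>
      (\<forall>\<omega>\<in>G. ennreal (r / 1) \<le> return_time X D \<delta> \<omega> \<and>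
        ennreal r \<le> (\<integral>\<^sup>+s\<in>{s. 0 \<le> s \<and> ennreal s \<le> return_time X D \<delta> \<omega>}. ennreal 1 \<partial>lborel))"
      using bound[where h="\<lambda>_. 1" and x=x, OF one] by (elim exE conjE) (rule that)
    have ge: "C / \<Psi> (2 * G_inv \<epsilon> \<phi> (\<lambda>_. 1) r / (1 - q)) \<le> event_prob (P x) {\<omega> \<in> space M. ennreal r \<le> return_time X D \<delta> \<omega>}"
      if "r0 < r" for r
      using G[rule_format, OF that]
    proof (elim bexE conjE)
      fix A assume A: "A \<in> sets (P x)" "C / \<Psi> (2 * G_inv \<epsilon> \<phi> (\<lambda>_. 1) r / (1 - q)) \<le> measure (P x) A" "A \<subseteq> space M"
        and returns: "\<forall>\<omega>\<in>A. ennreal (r / 1) \<le> return_time X D \<delta> \<omega> \<and>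
          ennreal r \<le> (\<integral>\<^sup>+s\<in>{s. 0 \<le> s \<and> ennreal s \<le> return_time X D \<delta> \<omega>}. ennreal 1 \<partial>lborel)"
      show ?thesis
        by (rule event_prob_ge[OF prob_space_P A(1) _ A(2)]) (use returns A(3) in auto)
    qed
    show "\<exists>C>0. \<exists>\<delta>>0. \<exists>t0>0. \<forall>t>t0.
      C / \<Psi> (2 * G_inv \<epsilon> \<phi> (\<lambda>_. 1) t / (1 - q)) \<le> event_prob (P x) {\<omega> \<in> space M. ennreal t \<le> return_time X D \<delta> \<omega>}"
      by (rule exI[of _ C], rule conjI[OF C(1)], rule exI[of _ \<delta>], rule conjI[OF C(3)],
          rule exI[of _ r0], rule conjI[OF C(2)], intro allI impI, rule ge)
  qed
qed

end
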